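(* Let $A$ be a finite ordered set, and $R$ a commutative unital ring. The exterior algebra $\Lambda(RA)$ injects, as an algebra, into the Hochschild cohomology $H^*(\mathbf{Pl}_A; R)$ of the plactic monoid on $A$, via the map $a \mapsto \zeta_a$.
   Context: $\mathbf{Pl}_A$ is the plactic monoid, the quotient of the free monoid $A^*$ by the Knuth relations $xzy \sim zxy$ for $x \le y < z$ and $yxz \sim yzx$ for $x < y \le z$. $H^*(\mathbf{Pl}_A;R)$ denotes Hochschild cohomology with trivial coefficients, i.e. with coefficients in $R$ where both actions of $\mathbf{Pl}_A$ are given by the constant character $\varepsilon_1\equiv 1_R$, with the usual cup product. $RA$ is the free $R$-module on $A$. For $a\in A$, $\zeta_a\colon \mathbf{Pl}_A \to R$ sends a word to the number of occurrences of the letter $a$ in it (times $1_R$); it is invariant under Knuth equivalence, additive, and the $\zeta_a$ form a basis of $H^1(\mathbf{Pl}_A;R)$. *)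

theory Defs
  imports "HOL-Algebra.QuotRing" "HOL-Algebra.Module"
begin

text \<open>
  The coefficient ring is a type of sort \<open>{comm_ring, comm_monoid_mult}\<close>: commutative rings with
  unit.  This is \<open>comm_ring_1\<close> without the axiom \<open>0 \<noteq> 1\<close>, so the zero ring is allowed.
\<close>

section \<open>The plactic monoid\<close>

inductive knuth_rel :: "'a::linorder set \<Rightarrow> 'a list \<Rightarrow> 'a list \<Rightarrow> bool" for A where
  knuth1: "\<lbrakk>x \<in> A; y \<in> A; z \<in> A; x \<le> y; y < z\<rbrakk> \<Longrightarrow> knuth_rel A [x, z, y] [z, x, y]"
| knuth2: "\<lbrakk>x \<in> A; y \<in> A; z \<in> A; x < y; y \<le> z\<rbrakk> \<Longrightarrow> knuth_rel A [y, x, z] [y, z, x]"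

inductive_set plactic_cong :: "'a::linorder set \<Rightarrow> ('a list \<times> 'a list) set" for A where
  plactic_rel: "knuth_rel A u v \<Longrightarrow> (u, v) \<in> plactic_cong A"
| plactic_refl: "u \<in> lists A \<Longrightarrow> (u, u) \<in> plactic_cong A"
| plactic_sym: "(u, v) \<in> plactic_cong A \<Longrightarrow> (v, u) \<in> plactic_cong A"
| plactic_trans: "\<lbrakk>(u, v) \<in> plactic_cong A; (v, w) \<in> plactic_cong A\<rbrakk> \<Longrightarrow> (u, w) \<in> plactic_cong A"
| plactic_mult: "\<lbrakk>(u, v) \<in> plactic_cong A; (u', v') \<in> plactic_cong A\<rbrakk> \<Longrightarrow> (u @ u', v @ v') \<in> plactic_cong A"

definition plactic_class :: "'a::linorder set \<Rightarrow> 'a list \<Rightarrow> 'a list set" where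
  "plactic_class A w = plactic_cong A `` {w}"

definition plactic :: "'a::linorder set \<Rightarrow> 'a list set monoid" where
  "plactic A = \<lparr>carrier = lists A // plactic_cong A,
     mult = (\<lambda>X Y. \<Union>u\<in>X. \<Union>v\<in>Y. plactic_class A (u @ v)),
     one = plactic_class A []\<rparr>"


section \<open>Algebras of functions on words, and quotient algebras\<close>

text \<open>
  A function \<open>F\<close> on words over \<open>'b\<close> is regarded as the sum of its homogeneous components, the
  component of degree \<open>n\<close> being the restriction of \<open>F\<close> to the words of length \<open>n\<close>.  The product is
  \<open>(F \<cdot> G)(w) = (\<Sum>u @ v = w. F u * G v)\<close>.  On finitely supported functions it is the product of the
  free algebra (concatenation of words).  For homogeneous \<open>F\<close> and \<open>G\<close> of degrees \<open>p\<close> and \<open>q\<close> it is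
  \<open>(F \<cdot> G)(m\<^sub>1, \<dots>, m\<^sub>p\<^sub>+\<^sub>q) = F(m\<^sub>1, \<dots>, m\<^sub>p) * G(m\<^sub>p\<^sub>+\<^sub>1, \<dots>, m\<^sub>p\<^sub>+\<^sub>q)\<close>, the cup product of cochains.
\<close>

definition word_mult ::
    "('b list \<Rightarrow> 'r::{comm_ring, comm_monoid_mult}) \<Rightarrow> ('b list \<Rightarrow> 'r) \<Rightarrow> 'b list \<Rightarrow> 'r" where
  "word_mult F G = (\<lambda>w. \<Sum>k\<le>length w. F (take k w) * G (drop k w))"

definition word_single :: "'b list \<Rightarrow> 'b list \<Rightarrow> 'r::{comm_ring, comm_monoid_mult}" where
  "word_single u = (\<lambda>w. if w = u then 1 else 0)"

definition word_algebra ::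
    "('b list \<Rightarrow> 'r::{comm_ring, comm_monoid_mult}) set \<Rightarrow> ('r, 'b list \<Rightarrow> 'r) module" where
  "word_algebra S = \<lparr>carrier = S, mult = word_mult, one = word_single [], zero = (\<lambda>w. 0),
     add = (\<lambda>F G w. F w + G w), smult = (\<lambda>r F w. r * F w)\<rparr>"

text \<open>The quotient of an algebra by a two-sided ideal \<open>I\<close> that is stable under scalars.\<close>

definition quot_algebra :: "('r, 'c) module \<Rightarrow> 'c set \<Rightarrow> ('r, 'c set) module" where
  "quot_algebra X I = \<lparr>carrier = carrier (X Quot I), mult = mult (X Quot I),
     one = one (X Quot I), zero = zero (X Quot I), add = add (X Quot I),
     smult = (\<lambda>r C. \<Union>x\<in>C. I +>\<^bsub>X\<^esub> (r \<odot>\<^bsub>X\<^esub> x))\<rparr>"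

definition algebra_hom :: "('r, 'c) module \<Rightarrow> ('r, 'd) module \<Rightarrow> ('c \<Rightarrow> 'd) set" where
  "algebra_hom X Y = {h \<in> ring_hom X Y. \<forall>r. \<forall>x\<in>carrier X. h (r \<odot>\<^bsub>X\<^esub> x) = r \<odot>\<^bsub>Y\<^esub> h x}"


section \<open>The exterior algebra of the free module on a set\<close>

text \<open>
  The tensor algebra of \<open>RA\<close> has the words over \<open>A\<close> as a basis; \<open>RA\<close> sits in it as the span of the
  words of length one.
\<close>

definition tensor_algebra ::
    "'a set \<Rightarrow> ('r::{comm_ring, comm_monoid_mult}, 'a list \<Rightarrow> 'r) module" where
  "tensor_algebra A = word_algebra {F. finite {w. F w \<noteq> 0} \<and> {w. F w \<noteq> 0} \<subseteq> lists A}"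

definition free_module :: "'a set \<Rightarrow> ('a list \<Rightarrow> 'r::{comm_ring, comm_monoid_mult}) set" where
  "free_module A = {v \<in> carrier (tensor_algebra A). \<forall>w. v w \<noteq> 0 \<longrightarrow> length w = 1}"

definition exterior_ideal :: "'a set \<Rightarrow> ('a list \<Rightarrow> 'r::{comm_ring, comm_monoid_mult}) set" where
  "exterior_ideal A =
     Idl\<^bsub>tensor_algebra A\<^esub> {v \<otimes>\<^bsub>tensor_algebra A\<^esub> v | v. v \<in> free_module A}"

definition exterior_algebra ::
    "'a set \<Rightarrow> ('r::{comm_ring, comm_monoid_mult}, ('a list \<Rightarrow> 'r) set) module" where
  "exterior_algebra A = quot_algebra (tensor_algebra A) (exterior_ideal A)"

definition exterior_gen :: "'a set \<Rightarrow> 'a \<Rightarrow> ('a list \<Rightarrow> 'r::{comm_ring, comm_monoid_mult}) set" where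
  "exterior_gen A a = exterior_ideal A +>\<^bsub>tensor_algebra A\<^esub> word_single [a]"


section \<open>Hochschild cohomology of a monoid with coefficients in the base ring\<close>

text \<open>
  An \<open>n\<close>-cochain, i.e. an \<open>R\<close>-multilinear map on \<open>n\<close>-tuples of elements of the monoid algebra, is
  given by its values on \<open>n\<close>-tuples of elements of \<open>M\<close>.  A cochain of the total complex
  \<open>\<Oplus>\<^sub>n C\<^sup>n\<close> is thus a function on lists over \<open>carrier M\<close> (extended by \<open>0\<close>) which vanishes on all
  sufficiently long lists.
\<close>

definition cochains :: "('m, 'k) monoid_scheme \<Rightarrow> ('m list \<Rightarrow> 'r::{comm_ring, comm_monoid_mult}) set" where
  "cochains M = {F. {ms. F ms \<noteq> 0} \<subseteq> lists (carrier M) \<and> (\<exists>N. \<forall>ms. N < length ms \<longrightarrow> F ms = 0)}"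

definition alt_sign :: "nat \<Rightarrow> 'r::{comm_ring, comm_monoid_mult} \<Rightarrow> 'r" where
  "alt_sign n x = (if even n then x else - x)"

text \<open>
  The Hochschild differential with coefficients in \<open>R\<close>, where \<open>M\<close> acts on the left through the
  character \<open>\<phi>\<close> and on the right through the character \<open>\<psi>\<close>.  For \<open>ms = (m\<^sub>0, \<dots>, m\<^sub>n)\<close> the value is
  \<open>\<phi>(m\<^sub>0) F(m\<^sub>1, \<dots>, m\<^sub>n) + (\<Sum>i<n. (-1)\<^sup>i\<^sup>+\<^sup>1 F(m\<^sub>0, \<dots>, m\<^sub>i m\<^sub>i\<^sub>+\<^sub>1, \<dots>, m\<^sub>n)) + (-1)\<^sup>n\<^sup>+\<^sup>1 F(m\<^sub>0, \<dots>, m\<^sub>n\<^sub>-\<^sub>1) \<psi>(m\<^sub>n)\<close>.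
\<close>

definition hochschild_d ::
    "('m, 'k) monoid_scheme \<Rightarrow> ('m \<Rightarrow> 'r) \<Rightarrow> ('m \<Rightarrow> 'r) \<Rightarrow> ('m list \<Rightarrow> 'r)
       \<Rightarrow> 'm list \<Rightarrow> 'r::{comm_ring, comm_monoid_mult}" where
  "hochschild_d M \<phi> \<psi> F = (\<lambda>ms. if ms = [] \<or> ms \<notin> lists (carrier M) then 0 else
     \<phi> (hd ms) * F (tl ms)
     + (\<Sum>i<length ms - 1. alt_sign (i + 1)
          (F (take i ms @ [(ms ! i) \<otimes>\<^bsub>M\<^esub> (ms ! (i + 1))] @ drop (i + 2) ms)))
     + alt_sign (length ms) (F (butlast ms) * \<psi> (last ms)))"

definition eps1 :: "'m \<Rightarrow> 'r::{comm_ring, comm_monoid_mult}" where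
  "eps1 = (\<lambda>m. 1)"

text \<open>
  As the differential is homogeneous of degree one, the cohomology of the total complex below is
  the direct sum of the cohomology modules in the individual degrees.
\<close>

definition cocycles :: "('m, 'k) monoid_scheme \<Rightarrow> ('m list \<Rightarrow> 'r::{comm_ring, comm_monoid_mult}) set" where
  "cocycles M = {F \<in> cochains M. hochschild_d M eps1 eps1 F = (\<lambda>ms. 0)}"

definition coboundaries :: "('m, 'k) monoid_scheme \<Rightarrow> ('m list \<Rightarrow> 'r::{comm_ring, comm_monoid_mult}) set" where
  "coboundaries M = hochschild_d M eps1 eps1 ` cochains M"

definition hochschild_cohomology ::
    "('m, 'k) monoid_scheme \<Rightarrow> ('r::{comm_ring, comm_monoid_mult}, ('m list \<Rightarrow> 'r) set) module" where
  "hochschild_cohomology M = quot_algebra (word_algebra (cocycles M)) (coboundaries M)"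

definition cohomology_class ::
    "('m, 'k) monoid_scheme \<Rightarrow> ('m list \<Rightarrow> 'r::{comm_ring, comm_monoid_mult}) \<Rightarrow> ('m list \<Rightarrow> 'r) set" where
  "cohomology_class M F = coboundaries M +>\<^bsub>word_algebra (cocycles M)\<^esub> F"

definition cochain1 :: "('m, 'k) monoid_scheme \<Rightarrow> ('m \<Rightarrow> 'r) \<Rightarrow> 'm list \<Rightarrow> 'r::{comm_ring, comm_monoid_mult}" where
  "cochain1 M f = (\<lambda>ms. case ms of [m] \<Rightarrow> if m \<in> carrier M then f m else 0 | _ \<Rightarrow> 0)"


section \<open>The letter-counting characters\<close>

text \<open>
  The choice of the representative is immaterial: the Knuth relations preserve the number of
  occurrences of each letter.  The sum over \<open>{..<n}\<close> is the \<open>n\<close>-fold multiple of \<open>1\<close>.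
\<close>

definition zeta :: "'a \<Rightarrow> 'a list set \<Rightarrow> 'r::{comm_ring, comm_monoid_mult}" where
  "zeta a X = (\<Sum>i<count_list (SOME w. w \<in> X) a. 1)"

end

theory Submission
  imports Defs
begin

text \<open>
  The tensor algebra maps to cochains by sending \<open>a\<^sub>1\<dots>a\<^sub>p\<close> to the cup product of the cocycles \<open>\<zeta>\<^sub>a\<^sub>i\<close>.
  The square of \<open>\<Sum> v\<^sub>a \<zeta>\<^sub>a\<close> is the coboundary of minus the second elementary symmetric function of the
  values \<open>v\<^sub>a\<close> at the letters of a word, so the map descends to the exterior algebra.

  For injectivity, let \<open>c\<^sub>a\<close> be the class of the column, i.e. the decreasing word, of all letters \<open>\<le> a\<close>.
  A letter of a column commutes with it in the plactic monoid, so the \<open>c\<^sub>a\<close> commute pairwise, and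
  \<open>\<zeta>\<^sub>b(c\<^sub>a)\<close> is \<open>1\<close> if \<open>b \<le> a\<close> and \<open>0\<close> otherwise.  The signed sum over all ways to insert an element
  \<open>m\<close> into the arguments of a cochain anticommutes with the differential on arguments commuting with
  \<open>m\<close>, and on cup products of characters it is the contraction with \<open>b \<mapsto> \<zeta>\<^sub>b(m)\<close>.  As the matrix
  \<open>(\<zeta>\<^sub>b(c\<^sub>a))\<close> is unitriangular, a combination of increasing words that maps to a coboundary can be
  contracted with every letter, and repeated contraction yields that all its coefficients vanish.
\<close>

section \<open>Products of functions on words\<close>

lemma word_mult_Nil [simp]: "word_mult F G [] = F [] * G []"
  by (simp add: word_mult_def)

text \<open>The cut at position 0 is split off; the other cuts form a product with \<open>F\<close>
  shifted by \<open>x\<close>. Many inductions below rest on this recursion and hence generalise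
  over \<open>F\<close>.\<close>

lemma word_mult_Cons [simp]:
  "word_mult F G (x # w) = F [] * G (x # w) + word_mult (\<lambda>u. F (x # u)) G w"
  by (simp add: word_mult_def sum.atMost_Suc_shift del: sum.atMost_Suc)

lemma word_mult_add_left:
  "word_mult (\<lambda>u. F u + F' u) G w = word_mult F G w + word_mult F' G w"
  by (simp add: word_mult_def distrib_right sum.distrib)

lemma word_mult_add_right:
  "word_mult F (\<lambda>u. G u + G' u) w = word_mult F G w + word_mult F G' w"
  by (simp add: word_mult_def distrib_left sum.distrib)

lemma word_mult_diff_left:
  "word_mult (\<lambda>u. F u - F' u) G w = word_mult F G w - word_mult F' G w"
  by (simp add: word_mult_def left_diff_distrib sum_subtractf)

lemma word_mult_diff_right:
  "word_mult F (\<lambda>u. G u - G' u) w = word_mult F G w - word_mult F G' w"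
  by (simp add: word_mult_def right_diff_distrib sum_subtractf)

lemma word_mult_scale_left: "word_mult (\<lambda>u. r * F u) G w = r * word_mult F G w"
  by (simp add: word_mult_def sum_distrib_left mult.assoc)

lemma word_mult_scale_right: "word_mult F (\<lambda>u. r * G u) w = r * word_mult F G w"
  by (simp add: word_mult_def sum_distrib_left mult.left_commute)

lemma word_mult_zero_left: "word_mult (\<lambda>u. 0) G w = 0"
  by (simp add: word_mult_def)

lemma word_mult_zero_right: "word_mult F (\<lambda>u. 0) w = 0"
  by (simp add: word_mult_def)

lemma word_mult_uminus_left: "word_mult (\<lambda>u. - F u) G w = - word_mult F G w"
  by (simp add: word_mult_def sum_negf)

lemma word_mult_sum_left:
  "word_mult (\<lambda>u. \<Sum>a\<in>A. F a u) G w = (\<Sum>a\<in>A. word_mult (F a) G w)"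
  by (induction A rule: infinite_finite_induct)
    (simp_all add: word_mult_zero_left word_mult_add_left)

lemma word_mult_assoc: "word_mult (word_mult F G) H w = word_mult F (word_mult G H) w"
  by (induction w arbitrary: F G)
    (simp_all add: algebra_simps word_mult_add_left word_mult_scale_left)

lemma word_mult_one_left: "word_mult (word_single []) F w = F w"
  by (cases w) (simp_all add: word_single_def word_mult_zero_left)

lemma word_mult_one_right: "word_mult F (word_single []) w = F w"
  by (induction w arbitrary: F) (simp_all add: word_single_def)

lemma word_mult_cong:
  assumes "\<And>k. k \<le> length w \<Longrightarrow> F (take k w) = F' (take k w)"
    and "\<And>k. k \<le> length w \<Longrightarrow> G (drop k w) = G' (drop k w)"
  shows "word_mult F G w = word_mult F' G' w"
  using assms by (simp add: word_mult_def)

lemma word_mult_eq_0: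
  assumes "\<And>k. k \<le> length w \<Longrightarrow> F (take k w) = 0 \<or> G (drop k w) = 0"
  shows "word_mult F G w = 0"
  using assms by (force simp add: word_mult_def intro: sum.neutral)

lemma word_mult_outside:
  assumes "{w. F w \<noteq> 0} \<subseteq> lists S" "{w. G w \<noteq> 0} \<subseteq> lists S" "w \<notin> lists S"
  shows "word_mult F G w = 0"
proof (rule word_mult_eq_0)
  fix k
  have "take k w \<notin> lists S \<or> drop k w \<notin> lists S"
    using assms(3) by (metis append_in_lists_conv append_take_drop_id)
  then show "F (take k w) = 0 \<or> G (drop k w) = 0"
    using assms(1,2) by blast
qed

section \<open>The bar differential\<close>

text \<open>The Hochschild differential for trivial coefficients, unrolled from the left. The term
  \<open>F (x # w)\<close> cancels the first face of the recursive call, since omitting an inner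
  letter is not a face of the whole list. On \<open>[x]\<close> the two outer faces cancel.\<close>

fun bar_d :: "('m \<Rightarrow> 'm \<Rightarrow> 'm) \<Rightarrow> ('m list \<Rightarrow> 'r) \<Rightarrow> 'm list \<Rightarrow> 'r::{comm_ring, comm_monoid_mult}" where
  "bar_d f F [] = 0"
| "bar_d f F [x] = 0"
| "bar_d f F (x # y # w) = F (y # w) - F (f x y # w) + F (x # w) - bar_d f (\<lambda>u. F (x # u)) (y # w)"

lemma alt_sign_Suc: "alt_sign (Suc n) x = - alt_sign n x"
  by (simp add: alt_sign_def)

lemma alt_sign_0: "alt_sign 0 x = x"
  by (simp add: alt_sign_def)

lemma hochschild_d_eq_bar_d:
  assumes "ms \<in> lists (carrier M)"
  shows "hochschild_d M eps1 eps1 F ms = bar_d (mult M) F ms"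
proof (cases ms)
  case Nil
  then show ?thesis by (simp add: hochschild_d_def)
next
  case (Cons x w)
  have "F w
     + (\<Sum>i<length w. alt_sign (i + 1)
          (F (take i (x # w) @ [((x # w) ! i) \<otimes>\<^bsub>M\<^esub> (w ! i)] @ drop (Suc i) w)))
     + alt_sign (Suc (length w)) (F (butlast (x # w))) = bar_d (mult M) F (x # w)"
  proof (induction w arbitrary: x F)
    case Nil
    then show ?case by (simp add: alt_sign_def)
  next
    case (Cons y w)
    show ?case
      using Cons[of "\<lambda>u. F (x # u)" y, symmetric]
      by (simp add: sum.lessThan_Suc_shift alt_sign_Suc alt_sign_0 sum_negf algebra_simps
          del: sum.lessThan_Suc)
  qed
  with Cons assms show ?thesis
    by (simp add: hochschild_d_def eps1_def)
qed

lemma hochschild_d_outside: "ms \<notin> lists (carrier M) \<Longrightarrow> hochschild_d M \<phi> \<psi> F ms = 0"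
  by (simp add: hochschild_d_def)

lemma bar_d_add: "bar_d f (\<lambda>u. F u + G u) w = bar_d f F w + bar_d f G w"
  by (induction f F w arbitrary: G rule: bar_d.induct) simp_all

lemma bar_d_scale: "bar_d f (\<lambda>u. r * F u) w = r * bar_d f F w"
  by (induction f F w rule: bar_d.induct) (simp_all add: algebra_simps)

lemma bar_d_zero: "bar_d f (\<lambda>u. 0) w = 0"
  using bar_d_scale[of f 0 "\<lambda>u. 0"] by simp

lemma bar_d_uminus: "bar_d f (\<lambda>u. - F u) w = - bar_d f F w"
  by (induction f F w rule: bar_d.induct) (simp_all add: algebra_simps)

lemma bar_d_diff: "bar_d f (\<lambda>u. F u - G u) w = bar_d f F w - bar_d f G w"
  using bar_d_add[of f F "\<lambda>u. - G u"] by (simp add: bar_d_uminus)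

lemma bar_d_sum: "bar_d f (\<lambda>u. \<Sum>a\<in>A. F a u) w = (\<Sum>a\<in>A. bar_d f (F a) w)"
  by (induction A rule: infinite_finite_induct) (simp_all add: bar_d_zero bar_d_add)

lemma bar_d_cong:
  assumes "\<And>x y. x \<in> S \<Longrightarrow> y \<in> S \<Longrightarrow> f x y \<in> S" "\<And>u. u \<in> lists S \<Longrightarrow> F u = G u" "w \<in> lists S"
  shows "bar_d f F w = bar_d f G w"
  using assms(2,3)
proof (induction w arbitrary: F G rule: induct_list012)
  case (3 x y w)
  have "bar_d f (\<lambda>u. F (x # u)) (y # w) = bar_d f (\<lambda>u. G (x # u)) (y # w)"
    using 3(3,4) by (intro 3(2)) simp_all
  moreover have "F (y # w) = G (y # w)" "F (f x y # w) = G (f x y # w)" "F (x # w) = G (x # w)"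
    using 3(3,4) assms(1) by simp_all
  ultimately show ?case
    by simp
qed simp_all

lemma bar_d_bar_d:
  assumes "\<And>x y. x \<in> S \<Longrightarrow> y \<in> S \<Longrightarrow> f x y \<in> S"
    and "\<And>x y z. x \<in> S \<Longrightarrow> y \<in> S \<Longrightarrow> z \<in> S \<Longrightarrow> f (f x y) z = f x (f y z)"
    and "w \<in> lists S"
  shows "bar_d f (bar_d f F) w = 0"
  using assms(3)
proof (induction w arbitrary: F rule: induct_list012)
  case (3 x y w)
  show ?case
  proof (cases w)
    case Nil
    then show ?thesis by simp
  next
    case (Cons z v)
    \<comment> \<open>\<open>K\<close> is the part of \<open>bar_d f F (x # u)\<close> outside the
      recursive call. Linearity then leaves the induction hypothesis for
      \<open>\<lambda>v. F (x # v)\<close> and a cancellation of faces at the front, where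
      associativity identifies the iterated products.\<close>
    define K where "K u = (case u of [] \<Rightarrow> 0 | y # w \<Rightarrow> F (y # w) - F (f x y # w) + F (x # w))" for u
    have "(\<lambda>u. bar_d f F (x # u)) = (\<lambda>u. K u - bar_d f (\<lambda>v. F (x # v)) u)"
      by (auto simp: K_def fun_eq_iff split: list.split)
    moreover have "bar_d f (bar_d f (\<lambda>v. F (x # v))) (y # w) = 0"
      using 3 by simp
    ultimately show ?thesis
      using Cons 3(3) assms(2)
      by (simp add: bar_d_diff bar_d_add K_def algebra_simps)
  qed
qed simp_all

text \<open>The sign of the graded Leibniz rule, (-1)^p in degree p. It is an operator because a
  cochain may have components in several degrees.\<close>

definition sign_twist :: "('m list \<Rightarrow> 'r) \<Rightarrow> 'm list \<Rightarrow> 'r::{comm_ring, comm_monoid_mult}" where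
  "sign_twist F w = alt_sign (length w) (F w)"

lemma sign_twist_Cons: "(\<lambda>u. sign_twist F (x # u)) = (\<lambda>u. - sign_twist (\<lambda>v. F (x # v)) u)"
  by (simp add: sign_twist_def alt_sign_Suc fun_eq_iff)

lemma sign_twist_twist [simp]: "sign_twist (sign_twist F) = F"
  by (simp add: sign_twist_def alt_sign_def fun_eq_iff)

lemma bar_d_sign_twist: "bar_d f (sign_twist F) w = - sign_twist (bar_d f F) w"
proof (induction f F w rule: bar_d.induct)
  case (3 f F x y w)
  then show ?case
    by (simp add: sign_twist_Cons bar_d_uminus) (simp add: sign_twist_def alt_sign_def)
qed (simp_all add: sign_twist_def alt_sign_def)

text \<open>The graded Leibniz rule. With the first letter \<open>x\<close> fixed, a product becomes
  a multiple of \<open>G\<close> shifted by \<open>x\<close> plus a product with \<open>F\<close>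
  shifted by \<open>x\<close>; the induction hypothesis handles the latter.\<close>

lemma bar_d_word_mult:
  "bar_d f (word_mult F G) w = word_mult (bar_d f F) G w + word_mult (sign_twist F) (bar_d f G) w"
proof (induction w arbitrary: F rule: induct_list012)
  case (3 x y w)
  have "(\<lambda>u. word_mult F G (x # u)) = (\<lambda>u. F [] * G (x # u) + word_mult (\<lambda>v. F (x # v)) G u)"
    by simp
  then show ?case
    using 3(2)[of "\<lambda>v. F (x # v)"]
    by (simp add: bar_d_add bar_d_scale sign_twist_Cons word_mult_uminus_left word_mult_add_left
        word_mult_diff_left)
      (simp add: sign_twist_def alt_sign_def algebra_simps)
qed (simp_all add: word_mult_zero_left)

section \<open>Insertion of a letter\<close>

fun insertion :: "'m \<Rightarrow> ('m list \<Rightarrow> 'r) \<Rightarrow> 'm list \<Rightarrow> 'r::{comm_ring, comm_monoid_mult}" where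
  "insertion m F [] = F [m]"
| "insertion m F (x # w) = F (m # x # w) - insertion m (\<lambda>u. F (x # u)) w"

lemma insertion_add: "insertion m (\<lambda>u. F u + G u) w = insertion m F w + insertion m G w"
  by (induction m F w arbitrary: G rule: insertion.induct) simp_all

lemma insertion_scale: "insertion m (\<lambda>u. r * F u) w = r * insertion m F w"
  by (induction m F w rule: insertion.induct) (simp_all add: algebra_simps)

lemma insertion_uminus: "insertion m (\<lambda>u. - F u) w = - insertion m F w"
  by (induction m F w rule: insertion.induct) (simp_all add: algebra_simps)

lemma insertion_diff: "insertion m (\<lambda>u. F u - G u) w = insertion m F w - insertion m G w"
  using insertion_add[of m F "\<lambda>u. - G u"] by (simp add: insertion_uminus)

lemma insertion_zero: "insertion m (\<lambda>u. 0) w = 0"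
  using insertion_scale[of m 0 "\<lambda>u. 0"] by simp

lemma insertion_sum: "insertion m (\<lambda>u. \<Sum>a\<in>A. F a u) w = (\<Sum>a\<in>A. insertion m (F a) w)"
  by (induction A rule: infinite_finite_induct) (simp_all add: insertion_zero insertion_add)

lemma insertion_cong:
  assumes "m \<in> S" "\<And>u. u \<in> lists S \<Longrightarrow> F u = G u" "w \<in> lists S"
  shows "insertion m F w = insertion m G w"
  using assms
proof (induction m F w arbitrary: G rule: insertion.induct)
  case (2 m F x w)
  have "insertion m (\<lambda>u. F (x # u)) w = insertion m (\<lambda>u. G (x # u)) w"
    using 2(2-) by (intro 2(1)) simp_all
  moreover have "F (m # x # w) = G (m # x # w)"
    using 2(2-) by simp
  ultimately show ?case
    by simp
qed simp

text \<open>
  Insertion is the shuffle product with \<open>[m]\<close>; on the bar complex of a commutative monoid the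
  shuffle product with the cycle \<open>[m]\<close> is a chain map up to sign.
\<close>

lemma insertion_bar_d:
  assumes "\<And>x. x \<in> set w \<Longrightarrow> f m x = f x m"
  shows "insertion m (bar_d f F) w = - bar_d f (insertion m F) w"
  using assms
proof (induction w arbitrary: F rule: induct_list012)
  case (3 x y w)
  define K where "K u = (case u of [] \<Rightarrow> 0 | y # w \<Rightarrow> F (y # w) - F (f x y # w) + F (x # w))" for u
  have "(\<lambda>u. bar_d f F (x # u)) = (\<lambda>u. K u - bar_d f (\<lambda>v. F (x # v)) u)"
    by (auto simp: K_def fun_eq_iff split: list.split)
  moreover have "insertion m (bar_d f (\<lambda>v. F (x # v))) (y # w) = - bar_d f (insertion m (\<lambda>v. F (x # v))) (y # w)"
    using 3 by simp
  \<comment> \<open>Inserting \<open>m\<close> just before and just after \<open>x\<close> produces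
    the faces with \<open>f m x\<close> and \<open>f x m\<close> with opposite signs; commutation
    makes them cancel.\<close>
  moreover have "f m x = f x m"
    using 3 by simp
  ultimately show ?case
    by (simp add: insertion_diff insertion_add bar_d_diff bar_d_add K_def algebra_simps)
qed simp_all

section \<open>Evaluation of tensors on characters\<close>

text \<open>Substitutes the functions \<open>z a\<close> for the letters of a tensor: on a list
  \<open>m1, ..., mp\<close> this is the sum over all words \<open>a1 ... ap\<close> over
  \<open>A\<close> of \<open>F [a1, ..., ap]\<close> times the product of the
  \<open>z ai mi\<close>, a combination of p-fold cup products.\<close>

fun tensor_eval :: "'a set \<Rightarrow> ('a \<Rightarrow> 'm \<Rightarrow> 'r) \<Rightarrow> ('a list \<Rightarrow> 'r) \<Rightarrow> 'm list \<Rightarrow> 'r::{comm_ring, comm_monoid_mult}" where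
  "tensor_eval A z F [] = F []"
| "tensor_eval A z F (m # ms) = (\<Sum>a\<in>A. z a m * tensor_eval A z (\<lambda>u. F (a # u)) ms)"

lemma tensor_eval_add: "tensor_eval A z (\<lambda>u. F u + G u) w = tensor_eval A z F w + tensor_eval A z G w"
  by (induction w arbitrary: F G) (simp_all add: distrib_left sum.distrib)

lemma tensor_eval_scale: "tensor_eval A z (\<lambda>u. r * F u) w = r * tensor_eval A z F w"
  by (induction w arbitrary: F) (simp_all add: sum_distrib_left mult.left_commute)

lemma tensor_eval_diff: "tensor_eval A z (\<lambda>u. F u - G u) w = tensor_eval A z F w - tensor_eval A z G w"
  by (induction w arbitrary: F G) (simp_all add: right_diff_distrib sum_subtractf)

lemma tensor_eval_eq_0:
  assumes "\<And>u. length u = length w \<Longrightarrow> F u = 0"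
  shows "tensor_eval A z F w = 0"
  using assms by (induction w arbitrary: F) (simp_all add: sum.neutral)

lemma tensor_eval_word_mult:
  "tensor_eval A z (word_mult F G) w = word_mult (tensor_eval A z F) (tensor_eval A z G) w"
proof (induction w arbitrary: F)
  case (Cons m w)
  then show ?case
    by (simp add: tensor_eval_add tensor_eval_scale word_mult_sum_left word_mult_scale_left
        sum.distrib sum_distrib_left algebra_simps)
qed simp

text \<open>The factor \<open>z b m\<close> of the inserted argument can be pulled out together with
  its letter \<open>b\<close>, so inserting an argument becomes inserting letters into the tensor,
  weighted by \<open>z\<close>.\<close>

lemma insertion_tensor_eval:
  "insertion m (tensor_eval A z F) w = (\<Sum>b\<in>A. z b m * tensor_eval A z (insertion b F) w)"
proof (induction w arbitrary: F)
  case (Cons x w)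
  have "insertion m (\<lambda>u. tensor_eval A z F (x # u)) w
      = (\<Sum>a\<in>A. \<Sum>b\<in>A. z a x * (z b m * tensor_eval A z (insertion b (\<lambda>u. F (a # u))) w))"
    by (simp add: insertion_sum insertion_scale Cons sum_distrib_left)
  also have "\<dots> = (\<Sum>b\<in>A. z b m * (\<Sum>a\<in>A. z a x * tensor_eval A z (insertion b (\<lambda>u. F (a # u))) w))"
    by (subst sum.swap) (simp add: sum_distrib_left mult.left_commute)
  finally show ?case
    by (simp add: tensor_eval_diff sum_subtractf right_diff_distrib)
qed simp

text \<open>By additivity the face with \<open>f x y\<close> splits into its two neighbours and
  cancels them, and the recursive call vanishes by induction. Thus cup products of additive
  functions are cocycles.\<close>

lemma bar_d_tensor_eval:
  assumes "\<And>a x y. a \<in> A \<Longrightarrow> x \<in> S \<Longrightarrow> y \<in> S \<Longrightarrow> z a (f x y) = z a x + z a y"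
    and "w \<in> lists S"
  shows "bar_d f (tensor_eval A z F) w = 0"
  using assms(2)
proof (induction w arbitrary: F rule: induct_list012)
  case (3 x y w)
  have "bar_d f (\<lambda>u. tensor_eval A z F (x # u)) (y # w) = 0"
    using 3 by (simp add: bar_d_sum bar_d_scale del: bar_d.simps)
  moreover have "z a (f x y) = z a x + z a y" if "a \<in> A" for a
    using 3(3) assms(1) that by simp
  ultimately show ?case
    by (simp add: distrib_right sum.distrib)
qed simp_all

section \<open>Ideals and quotients of algebras of functions\<close>

lemma word_algebra_simps [simp]:
  "carrier (word_algebra S) = S"
  "mult (word_algebra S) = word_mult"
  "one (word_algebra S) = word_single []"
  "zero (word_algebra S) = (\<lambda>w. 0)"
  "add (word_algebra S) = (\<lambda>F G w. F w + G w)"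
  "smult (word_algebra S) = (\<lambda>r F w. r * F w)"
  by (simp_all add: word_algebra_def)

definition subalgebra_set :: "('b list \<Rightarrow> 'r::{comm_ring, comm_monoid_mult}) set \<Rightarrow> bool" where
  "subalgebra_set S \<longleftrightarrow> word_single [] \<in> S \<and> (\<forall>F\<in>S. \<forall>G\<in>S. (\<lambda>w. F w + G w) \<in> S)
     \<and> (\<forall>F\<in>S. \<forall>r. (\<lambda>w. r * F w) \<in> S) \<and> (\<forall>F\<in>S. \<forall>G\<in>S. word_mult F G \<in> S)"

lemma subalgebra_setD:
  assumes "subalgebra_set S"
  shows "word_single [] \<in> S"
    and "F \<in> S \<Longrightarrow> G \<in> S \<Longrightarrow> (\<lambda>w. F w + G w) \<in> S"
    and "F \<in> S \<Longrightarrow> (\<lambda>w. r * F w) \<in> S"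
    and "F \<in> S \<Longrightarrow> G \<in> S \<Longrightarrow> word_mult F G \<in> S"
    and "(\<lambda>w. 0) \<in> S"
    and "F \<in> S \<Longrightarrow> (\<lambda>w. - F w) \<in> S"
proof -
  show 1: "word_single [] \<in> S"
    and "F \<in> S \<Longrightarrow> G \<in> S \<Longrightarrow> (\<lambda>w. F w + G w) \<in> S"
    and 2: "F \<in> S \<Longrightarrow> (\<lambda>w. r * F w) \<in> S"
    and "F \<in> S \<Longrightarrow> G \<in> S \<Longrightarrow> word_mult F G \<in> S" for F G r
    using assms by (auto simp: subalgebra_set_def)
  show "(\<lambda>w. 0) \<in> S"
    using 2[OF 1, of 0] by simp
  show "F \<in> S \<Longrightarrow> (\<lambda>w. - F w) \<in> S"
    using 2[of F "- 1"] by simp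
qed

lemma word_algebra_ring:
  assumes "subalgebra_set S"
  shows "ring (word_algebra S)"
proof (rule ringI)
  note closed = subalgebra_setD[OF assms]
  show "abelian_group (word_algebra S)"
  proof (rule abelian_groupI)
    fix F
    assume "F \<in> carrier (word_algebra S)"
    then show "\<exists>G\<in>carrier (word_algebra S). G \<oplus>\<^bsub>word_algebra S\<^esub> F = \<zero>\<^bsub>word_algebra S\<^esub>"
      using closed(6)[of F] by (auto intro!: bexI[of _ "\<lambda>w. - F w"])
  qed (auto simp: closed algebra_simps)
  show "monoid (word_algebra S)"
    by (rule monoidI)
      (auto simp: closed word_mult_assoc word_mult_one_left word_mult_one_right fun_eq_iff)
qed (auto simp: word_mult_add_left word_mult_add_right fun_eq_iff)

lemma word_algebra_a_inv:
  assumes "subalgebra_set S" "F \<in> S"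
  shows "\<ominus>\<^bsub>word_algebra S\<^esub> F = (\<lambda>w. - F w)"
proof -
  interpret ring "word_algebra S" by (rule word_algebra_ring) fact
  show ?thesis
    using subalgebra_setD(6)[OF assms] assms(2) by (intro minus_equality) auto
qed

text \<open>This makes two-sided ideals stable under scalars and negation: a scalar acts as a factor
  taken from the algebra itself.\<close>

lemma word_mult_scalar: "word_mult (\<lambda>w. r * word_single [] w) F = (\<lambda>w. r * F w)"
  by (simp add: fun_eq_iff word_mult_scale_left word_mult_one_left)

lemma ideal_word_algebraI:
  assumes S: "subalgebra_set S"
    and "I \<subseteq> S" "(\<lambda>w. 0) \<in> I"
    and "\<And>F G. F \<in> I \<Longrightarrow> G \<in> I \<Longrightarrow> (\<lambda>w. F w + G w) \<in> I"
    and l: "\<And>F G. F \<in> I \<Longrightarrow> G \<in> S \<Longrightarrow> word_mult G F \<in> I"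
    and "\<And>F G. F \<in> I \<Longrightarrow> G \<in> S \<Longrightarrow> word_mult F G \<in> I"
  shows "ideal I (word_algebra S)"
proof (rule idealI)
  interpret ring "word_algebra S" by (rule word_algebra_ring) fact
  have uminus: "(\<lambda>w. - F w) \<in> I" if "F \<in> I" for F
    using l[OF that subalgebra_setD(3)[OF S subalgebra_setD(1)[OF S]], of "- 1"]
    unfolding word_mult_scalar by simp
  have "inv\<^bsub>add_monoid (word_algebra S)\<^esub> F \<in> I" if "F \<in> I" for F
    using word_algebra_a_inv[OF S, of F] that uminus assms(2) by (auto simp: a_inv_def)
  then show "subgroup I (add_monoid (word_algebra S))"
    using assms by unfold_locales auto
qed (use assms in \<open>auto intro: word_algebra_ring\<close>)

lemma ideal_word_algebraD:
  assumes S: "subalgebra_set S" and "ideal I (word_algebra S)"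
  shows "I \<subseteq> S" "(\<lambda>w. 0) \<in> I"
    and "F \<in> I \<Longrightarrow> G \<in> I \<Longrightarrow> (\<lambda>w. F w + G w) \<in> I"
    and "F \<in> I \<Longrightarrow> (\<lambda>w. r * F w) \<in> I"
    and "F \<in> I \<Longrightarrow> G \<in> I \<Longrightarrow> (\<lambda>w. F w - G w) \<in> I"
    and "F \<in> I \<Longrightarrow> G \<in> S \<Longrightarrow> word_mult G F \<in> I"
    and "F \<in> I \<Longrightarrow> G \<in> S \<Longrightarrow> word_mult F G \<in> I"
proof -
  interpret ideal I "word_algebra S" by fact
  show "I \<subseteq> S" "(\<lambda>w. 0) \<in> I"
    using a_subset additive_subgroup.zero_closed[OF is_additive_subgroup] by simp_all
  show add: "F \<in> I \<Longrightarrow> G \<in> I \<Longrightarrow> (\<lambda>w. F w + G w) \<in> I" for F G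
    using additive_subgroup.a_closed[OF is_additive_subgroup] by simp
  show l: "F \<in> I \<Longrightarrow> G \<in> S \<Longrightarrow> word_mult G F \<in> I" for F G
    using I_l_closed by simp
  show "F \<in> I \<Longrightarrow> G \<in> S \<Longrightarrow> word_mult F G \<in> I"
    using I_r_closed by simp
  show scale: "F \<in> I \<Longrightarrow> (\<lambda>w. r * F w) \<in> I" for F r
    using l[of F "\<lambda>w. r * word_single [] w"] subalgebra_setD(1,3)[OF S] by (simp add: word_mult_scalar)
  show "F \<in> I \<Longrightarrow> G \<in> I \<Longrightarrow> (\<lambda>w. F w - G w) \<in> I"
    using add[of F "\<lambda>w. - 1 * G w"] scale[of G "- 1"] by simp
qed

section \<open>Quotients of algebras and maps between them\<close>

definition scalar_algebra :: "('r, 'c) module \<Rightarrow> bool" where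
  "scalar_algebra X \<longleftrightarrow> ring X \<and> (\<forall>r. r \<odot>\<^bsub>X\<^esub> \<one>\<^bsub>X\<^esub> \<in> carrier X)
     \<and> (\<forall>r. \<forall>x\<in>carrier X. r \<odot>\<^bsub>X\<^esub> x = (r \<odot>\<^bsub>X\<^esub> \<one>\<^bsub>X\<^esub>) \<otimes>\<^bsub>X\<^esub> x)"

lemma scalar_algebraD:
  assumes "scalar_algebra X"
  shows "ring X" "r \<odot>\<^bsub>X\<^esub> \<one>\<^bsub>X\<^esub> \<in> carrier X"
    and "x \<in> carrier X \<Longrightarrow> r \<odot>\<^bsub>X\<^esub> x = (r \<odot>\<^bsub>X\<^esub> \<one>\<^bsub>X\<^esub>) \<otimes>\<^bsub>X\<^esub> x"
    and "x \<in> carrier X \<Longrightarrow> r \<odot>\<^bsub>X\<^esub> x \<in> carrier X"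
proof -
  show "ring X" and 1: "r \<odot>\<^bsub>X\<^esub> \<one>\<^bsub>X\<^esub> \<in> carrier X"
    and 2: "x \<in> carrier X \<Longrightarrow> r \<odot>\<^bsub>X\<^esub> x = (r \<odot>\<^bsub>X\<^esub> \<one>\<^bsub>X\<^esub>) \<otimes>\<^bsub>X\<^esub> x"
    using assms unfolding scalar_algebra_def by blast+
  interpret ring X by fact
  show "x \<in> carrier X \<Longrightarrow> r \<odot>\<^bsub>X\<^esub> x \<in> carrier X"
    using 1 by (subst 2) simp_all
qed

lemma scalar_algebra_word_algebra: "subalgebra_set S \<Longrightarrow> scalar_algebra (word_algebra S)"
  by (simp add: scalar_algebra_def word_algebra_ring subalgebra_setD word_mult_scalar)

text \<open>The ideal absorbs products and a scalar acts as a factor, so all representatives of a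
  coset yield the same coset, and the union in \<open>quot_algebra\<close> runs over copies of a
  single set.\<close>

lemma quot_algebra_smult:
  assumes "scalar_algebra X" "ideal I X" "x \<in> carrier X"
  shows "r \<odot>\<^bsub>quot_algebra X I\<^esub> (I +>\<^bsub>X\<^esub> x) = I +>\<^bsub>X\<^esub> (r \<odot>\<^bsub>X\<^esub> x)"
proof -
  interpret ideal I X by fact
  have "I +>\<^bsub>X\<^esub> (r \<odot>\<^bsub>X\<^esub> y) = I +>\<^bsub>X\<^esub> (r \<odot>\<^bsub>X\<^esub> x)" if "y \<in> I +>\<^bsub>X\<^esub> x" for y
  proof -
    have y: "y \<in> carrier X"
      using that assms(3) a_elemrcos_carrier by blast
    have "I +>\<^bsub>X\<^esub> y = I +>\<^bsub>X\<^esub> x"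
      using that assms(3) a_repr_independence a_subgroup by simp
    then have "I +>\<^bsub>X\<^esub> ((r \<odot>\<^bsub>X\<^esub> \<one>\<^bsub>X\<^esub>) \<otimes>\<^bsub>X\<^esub> y) = I +>\<^bsub>X\<^esub> ((r \<odot>\<^bsub>X\<^esub> \<one>\<^bsub>X\<^esub>) \<otimes>\<^bsub>X\<^esub> x)"
      using scalar_algebraD(2)[OF assms(1)] assms(3) y by (simp flip: rcoset_mult_add)
    then show ?thesis
      by (simp only: scalar_algebraD(3)[OF assms(1) y] scalar_algebraD(3)[OF assms(1,3)])
  qed
  moreover have "x \<in> I +>\<^bsub>X\<^esub> x"
    using assms(3) a_rcos_self by simp
  ultimately have "(\<Union>y\<in>I +>\<^bsub>X\<^esub> x. I +>\<^bsub>X\<^esub> (r \<odot>\<^bsub>X\<^esub> y)) = I +>\<^bsub>X\<^esub> (r \<odot>\<^bsub>X\<^esub> x)"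
    by blast
  then show ?thesis
    by (simp add: quot_algebra_def)
qed

lemma ring_hom_quot_algebra:
  "ring_hom (quot_algebra X I) (quot_algebra Y J) = ring_hom (X Quot I) (Y Quot J)"
  by (simp add: ring_hom_def quot_algebra_def)

text \<open>The first isomorphism theorem for the composite of \<open>h\<close> with the projection
  of \<open>Y\<close> modulo \<open>J\<close>, whose kernel is the preimage \<open>I\<close> of
  \<open>J\<close>.\<close>

lemma quot_algebra_injective_hom:
  fixes X :: "('r, 'c) module" and Y :: "('r, 'd) module"
  assumes X: "scalar_algebra X" and Y: "scalar_algebra Y" and J: "ideal J Y"
    and h: "h \<in> algebra_hom X Y"
    and I: "I = {x \<in> carrier X. h x \<in> J}"
  obtains \<Phi> where "\<Phi> \<in> algebra_hom (quot_algebra X I) (quot_algebra Y J)"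
    "inj_on \<Phi> (carrier (quot_algebra X I))"
    "\<And>x. x \<in> carrier X \<Longrightarrow> \<Phi> (I +>\<^bsub>X\<^esub> x) = J +>\<^bsub>Y\<^esub> h x"
proof -
  interpret J: ideal J Y by fact
  define g where "g = (\<lambda>x. J +>\<^bsub>Y\<^esub> h x)"
  have rings: "ring X" "ring Y"
    using X Y by (simp_all add: scalar_algebraD)
  have h': "h \<in> ring_hom X Y"
    using h by (simp add: algebra_hom_def)
  then have hY: "h x \<in> carrier Y" if "x \<in> carrier X" for x
    using that by (rule ring_hom_closed)
  interpret g: ring_hom_ring X "Y Quot J" g
  proof (rule ring_hom_ringI2)
    show "g \<in> ring_hom X (Y Quot J)"
      using ring_hom_trans[OF h' J.rcos_ring_hom] by (simp add: g_def comp_def)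
  qed (use rings J.quotient_is_ring in auto)
  have "J +>\<^bsub>Y\<^esub> y = J \<longleftrightarrow> y \<in> J" if "y \<in> carrier Y" for y
    using that J.a_rcos_const J.a_rcos_self by blast
  then have kernel: "a_kernel X (Y Quot J) g = I"
    using hY by (auto simp: a_kernel_def' I g_def FactRing_def)
  \<comment> \<open>\<open>g\<close> is constant on the cosets of its kernel, so the image of such a
    coset is a singleton.\<close>
  define \<Phi> where "\<Phi> = (\<lambda>C. the_elem (g ` C))"
  have \<Phi>: "\<Phi> (I +>\<^bsub>X\<^esub> x) = J +>\<^bsub>Y\<^esub> h x" if "x \<in> carrier X" for x
    using g.the_elem_simp[OF that] unfolding kernel by (simp add: \<Phi>_def g_def)
  have "ideal I X"
    using g.kernel_is_ideal by (simp add: kernel)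
  have "\<Phi> (r \<odot>\<^bsub>quot_algebra X I\<^esub> C) = r \<odot>\<^bsub>quot_algebra Y J\<^esub> \<Phi> C"
    if C: "C \<in> carrier (quot_algebra X I)" for r C
  proof -
    obtain x where x: "x \<in> carrier X" "C = I +>\<^bsub>X\<^esub> x"
      using C g.quot_mem[unfolded kernel] by (auto simp: quot_algebra_def)
    then have "r \<odot>\<^bsub>X\<^esub> x \<in> carrier X"
      using scalar_algebraD(4)[OF X] by simp
    then show ?thesis
      using x h hY \<open>ideal I X\<close> X Y J by (simp add: quot_algebra_smult \<Phi> algebra_hom_def)
  qed
  moreover have "\<Phi> \<in> ring_hom (quot_algebra X I) (quot_algebra Y J)"
    using g.the_elem_hom by (simp add: ring_hom_quot_algebra kernel \<Phi>_def)
  ultimately have "\<Phi> \<in> algebra_hom (quot_algebra X I) (quot_algebra Y J)"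
    by (simp add: algebra_hom_def)
  moreover have "inj_on \<Phi> (carrier (quot_algebra X I))"
    using g.the_elem_inj by (auto simp: inj_on_def kernel \<Phi>_def quot_algebra_def)
  ultimately show ?thesis
    using \<Phi> that by blast
qed

section \<open>The cohomology algebra of a monoid\<close>

lemma cochainsI:
  assumes "\<And>ms. ms \<notin> lists (carrier M) \<Longrightarrow> F ms = 0" "\<And>ms. n < length ms \<Longrightarrow> F ms = 0"
  shows "F \<in> cochains M"
  unfolding cochains_def using assms by blast

lemma cochains_outside: "F \<in> cochains M \<Longrightarrow> ms \<notin> lists (carrier M) \<Longrightarrow> F ms = 0"
  unfolding cochains_def by blast

lemma cochains_bounded:
  assumes "F \<in> cochains M"
  shows "\<exists>n. \<forall>ms. n < length ms \<longrightarrow> F ms = 0"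
  using assms unfolding cochains_def by blast

lemma cochains_word_mult:
  assumes "F \<in> cochains M" "G \<in> cochains M"
  shows "word_mult F G \<in> cochains M"
proof -
  obtain m where m: "\<forall>ms. m < length ms \<longrightarrow> F ms = 0"
    using cochains_bounded[OF assms(1)] by blast
  obtain n where n: "\<forall>ms. n < length ms \<longrightarrow> G ms = 0"
    using cochains_bounded[OF assms(2)] by blast
  show ?thesis
  proof (rule cochainsI)
    fix ms :: "'a list"
    assume len: "m + n < length ms"
    show "word_mult F G ms = 0"
    proof (rule word_mult_eq_0)
      fix k
      assume "k \<le> length ms"
      then show "F (take k ms) = 0 \<or> G (drop k ms) = 0"
        using len m[rule_format, of "take k ms"] n[rule_format, of "drop k ms"] by (cases "m < k") auto
    qed
  next
    fix ms
    assume "ms \<notin> lists (carrier M)"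
    then show "word_mult F G ms = 0"
      using assms by (intro word_mult_outside) (auto dest: cochains_outside)
  qed
qed

lemma subalgebra_set_cochains: "subalgebra_set (cochains M)"
  unfolding subalgebra_set_def
proof (intro conjI ballI allI)
  show "word_single [] \<in> cochains M"
    by (rule cochainsI[where n = 0]) (auto simp: word_single_def)
next
  fix F G :: "'a list \<Rightarrow> 'b"
  assume FG: "F \<in> cochains M" "G \<in> cochains M"
  obtain m where m: "\<forall>ms. m < length ms \<longrightarrow> F ms = 0"
    using cochains_bounded[OF FG(1)] by blast
  obtain n where n: "\<forall>ms. n < length ms \<longrightarrow> G ms = 0"
    using cochains_bounded[OF FG(2)] by blast
  show "(\<lambda>w. F w + G w) \<in> cochains M"
    by (rule cochainsI[where n = "max m n"]) (simp_all add: m n FG[THEN cochains_outside] del: in_lists_conv_set)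
next
  fix F :: "'a list \<Rightarrow> 'b" and r
  assume F: "F \<in> cochains M"
  obtain n where n: "\<forall>ms. n < length ms \<longrightarrow> F ms = 0"
    using cochains_bounded[OF F] by blast
  show "(\<lambda>w. r * F w) \<in> cochains M"
    by (rule cochainsI[where n = n]) (simp_all add: n F[THEN cochains_outside] del: in_lists_conv_set)
qed (rule cochains_word_mult)

lemma sign_twist_cochains:
  assumes "F \<in> cochains M"
  shows "sign_twist F \<in> cochains M"
proof -
  have "sign_twist F w = 0 \<longleftrightarrow> F w = 0" for w
    by (simp add: sign_twist_def alt_sign_def)
  then show ?thesis
    using assms by (simp add: cochains_def)
qed

section \<open>Cohomology as a quotient of the algebra of cocycles\<close>

context monoid
begin

lemma hochschild_d_alt:
  "hochschild_d G eps1 eps1 F = (\<lambda>ms. if ms \<in> lists (carrier G) then bar_d (mult G) F ms else 0)"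
  by (auto simp: fun_eq_iff hochschild_d_eq_bar_d hochschild_d_outside)

lemma hochschild_d_linear:
  "hochschild_d G eps1 eps1 (\<lambda>w. F w + F' w)
     = (\<lambda>w. hochschild_d G eps1 eps1 F w + hochschild_d G eps1 eps1 F' w)"
  "hochschild_d G eps1 eps1 (\<lambda>w. r * F w) = (\<lambda>w. r * hochschild_d G eps1 eps1 F w)"
  "hochschild_d G eps1 eps1 (\<lambda>w. 0) = (\<lambda>w. 0)"
  by (auto simp: hochschild_d_alt bar_d_add bar_d_scale bar_d_zero fun_eq_iff)

lemma hochschild_d_cochains:
  assumes "F \<in> cochains G"
  shows "hochschild_d G eps1 eps1 F \<in> cochains G"
proof -
  obtain n where n: "\<forall>ms. n < length ms \<longrightarrow> F ms = 0"
    using cochains_bounded[OF assms] by blast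
  \<comment> \<open>\<open>bar_d\<close> evaluates its argument only at lists one shorter than
    \<open>ms\<close>, so the degree bound rises by one.\<close>
  have "bar_d (mult G) F ms = 0" if "\<And>u. length ms \<le> Suc (length u) \<Longrightarrow> F u = 0" for F :: "'a list \<Rightarrow> 'c" and ms
    using that by (induction "mult G" F ms rule: bar_d.induct) simp_all
  then have "\<forall>ms. Suc n < length ms \<longrightarrow> hochschild_d G eps1 eps1 F ms = 0"
    using n by (auto simp: hochschild_d_alt)
  moreover have "{ms. hochschild_d G eps1 eps1 F ms \<noteq> 0} \<subseteq> lists (carrier G)"
    by (auto simp: hochschild_d_alt split: if_splits)
  ultimately show ?thesis
    unfolding cochains_def by blast
qed

lemma hochschild_d_hochschild_d:
  "hochschild_d G eps1 eps1 (hochschild_d G eps1 eps1 F) = (\<lambda>w. 0)"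
proof
  fix w
  show "hochschild_d G eps1 eps1 (hochschild_d G eps1 eps1 F) w = 0"
  proof (cases "w \<in> lists (carrier G)")
    case True
    then have "bar_d (mult G) (hochschild_d G eps1 eps1 F) w = bar_d (mult G) (bar_d (mult G) F) w"
      by (intro bar_d_cong[where S = "carrier G"]) (auto simp: hochschild_d_alt)
    also have "\<dots> = 0"
      using True by (intro bar_d_bar_d[where S = "carrier G"]) (auto simp: m_assoc)
    finally show ?thesis
      by (simp add: hochschild_d_alt)
  qed (simp add: hochschild_d_outside)
qed

lemma hochschild_d_word_mult:
  assumes "F \<in> cochains G" "F' \<in> cochains G"
  shows "hochschild_d G eps1 eps1 (word_mult F F')
    = (\<lambda>w. word_mult (hochschild_d G eps1 eps1 F) F' w
         + word_mult (sign_twist F) (hochschild_d G eps1 eps1 F') w)"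
proof
  fix w
  have supp: "{w. H w \<noteq> 0} \<subseteq> lists (carrier G)" if "H \<in> cochains G" for H :: "'a list \<Rightarrow> 'c"
    using that by (simp add: cochains_def)
  show "hochschild_d G eps1 eps1 (word_mult F F') w = word_mult (hochschild_d G eps1 eps1 F) F' w
         + word_mult (sign_twist F) (hochschild_d G eps1 eps1 F') w"
  proof (cases "w \<in> lists (carrier G)")
    case True
    have "take k w \<in> lists (carrier G)" "drop k w \<in> lists (carrier G)" for k
      using True by (metis append_in_lists_conv append_take_drop_id)+
    then have "word_mult (hochschild_d G eps1 eps1 F) F' w = word_mult (bar_d (mult G) F) F' w"
      "word_mult (sign_twist F) (hochschild_d G eps1 eps1 F') w
        = word_mult (sign_twist F) (bar_d (mult G) F') w"
      by (auto intro!: word_mult_cong simp: hochschild_d_alt)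
    with True show ?thesis
      by (simp add: hochschild_d_alt bar_d_word_mult)
  next
    case False
    then show ?thesis
      using word_mult_outside[OF supp supp False] assms
      by (simp add: hochschild_d_outside hochschild_d_cochains sign_twist_cochains)
  qed
qed

text \<open>The twist anticommutes with the differential. As the Leibniz rule twists the left
  factor, this is what left multiples of coboundaries require.\<close>

lemma sign_twist_cocycles:
  assumes "F \<in> cocycles G"
  shows "sign_twist F \<in> cocycles G"
proof -
  have "hochschild_d G eps1 eps1 (sign_twist F) w = - sign_twist (hochschild_d G eps1 eps1 F) w" for w
    by (simp add: hochschild_d_alt bar_d_sign_twist sign_twist_def alt_sign_def)
  then show ?thesis
    using assms by (simp add: cocycles_def sign_twist_cochains fun_eq_iff)
      (simp add: sign_twist_def alt_sign_def)
qed

lemma subalgebra_set_cocycles: "subalgebra_set (cocycles G)"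
proof -
  note closed = subalgebra_setD[OF subalgebra_set_cochains[of G]]
  have "hochschild_d G eps1 eps1 (word_single []) = (\<lambda>w. 0)"
  proof
    fix w
    show "hochschild_d G eps1 eps1 (word_single []) w = 0"
      by (cases "(mult G, word_single [] :: 'a list \<Rightarrow> 'c, w)" rule: bar_d.cases)
        (simp_all add: hochschild_d_alt word_single_def bar_d_zero)
  qed
  then show ?thesis
    unfolding subalgebra_set_def
    by (auto simp: cocycles_def closed hochschild_d_linear hochschild_d_word_mult
        word_mult_zero_left word_mult_zero_right)
qed

lemma ideal_coboundaries: "ideal (coboundaries G) (word_algebra (cocycles G))"
proof (rule ideal_word_algebraI[OF subalgebra_set_cocycles])
  note closed = subalgebra_setD[OF subalgebra_set_cochains[of G]]
  show "coboundaries G \<subseteq> cocycles G"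
    by (auto simp: coboundaries_def cocycles_def hochschild_d_cochains hochschild_d_hochschild_d)
  show "(\<lambda>w. 0) \<in> coboundaries G"
    unfolding coboundaries_def by (rule image_eqI[OF _ closed(5)]) (simp add: hochschild_d_linear)
  show "(\<lambda>w. F w + F' w) \<in> coboundaries G" if F: "F \<in> coboundaries G" "F' \<in> coboundaries G"
    for F F' :: "'a list \<Rightarrow> 'c"
    using that by (force simp: coboundaries_def closed simp flip: hochschild_d_linear)
next
  fix F F' :: "'a list \<Rightarrow> 'c"
  assume "F \<in> coboundaries G" and F': "F' \<in> cocycles G"
  then obtain H where H: "H \<in> cochains G" "F = hochschild_d G eps1 eps1 H"
    by (auto simp: coboundaries_def)
  \<comment> \<open>The Leibniz rule twists the left factor; starting from the twisted cocycle, the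
    second twist restores \<open>F'\<close>.\<close>
  have "word_mult F' F = hochschild_d G eps1 eps1 (word_mult (sign_twist F') H)"
    using sign_twist_cocycles[OF F'] H
    by (simp add: cocycles_def hochschild_d_word_mult word_mult_zero_left)
  moreover have "word_mult (sign_twist F') H \<in> cochains G"
    using sign_twist_cocycles[OF F'] H by (simp add: cocycles_def cochains_word_mult)
  ultimately show "word_mult F' F \<in> coboundaries G"
    unfolding coboundaries_def by blast
  have "word_mult F F' = hochschild_d G eps1 eps1 (word_mult H F')"
    using F' H by (simp add: cocycles_def hochschild_d_word_mult word_mult_zero_right)
  moreover have "word_mult H F' \<in> cochains G"
    using F' H by (simp add: cocycles_def cochains_word_mult)
  ultimately show "word_mult F F' \<in> coboundaries G"
    unfolding coboundaries_def by blast
qed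

end

section \<open>The plactic monoid\<close>

lemma plactic_cong_in_lists: "(u, v) \<in> plactic_cong A \<Longrightarrow> u \<in> lists A \<and> v \<in> lists A"
  by (induction rule: plactic_cong.induct) (auto elim: knuth_rel.cases)

lemma equiv_plactic_cong: "equiv (lists A) (plactic_cong A)"
proof (rule equivI)
  show "plactic_cong A \<subseteq> lists A \<times> lists A"
    by (auto dest: plactic_cong_in_lists)
  show "refl_on (lists A) (plactic_cong A)"
    by (intro refl_onI) (rule plactic_refl)
  show "sym (plactic_cong A)"
    by (intro symI) (rule plactic_sym)
  show "trans (plactic_cong A)"
    by (intro transI) (rule plactic_trans)
qed

lemma plactic_class_eq:
  "(u, v) \<in> plactic_cong A \<Longrightarrow> plactic_class A u = plactic_class A v"
  using equiv_class_eq[OF equiv_plactic_cong] by (simp add: plactic_class_def)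

lemma plactic_carrier: "carrier (plactic A) = plactic_class A ` lists A"
  by (auto simp: plactic_def quotient_def plactic_class_def)

lemma plactic_one: "one (plactic A) = plactic_class A []"
  by (simp add: plactic_def)

lemma plactic_class_mult:
  assumes "u \<in> lists A" "v \<in> lists A"
  shows "plactic_class A u \<otimes>\<^bsub>plactic A\<^esub> plactic_class A v = plactic_class A (u @ v)"
proof -
  have "plactic_class A (u' @ v') = plactic_class A (u @ v)"
    if "u' \<in> plactic_class A u" "v' \<in> plactic_class A v" for u' v'
    using that by (intro plactic_class_eq[symmetric] plactic_mult) (simp_all add: plactic_class_def)
  moreover have "u \<in> plactic_class A u" "v \<in> plactic_class A v"
    using assms by (auto simp: plactic_class_def plactic_refl)
  ultimately have "(\<Union>u'\<in>plactic_class A u. \<Union>v'\<in>plactic_class A v. plactic_class A (u' @ v'))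
      = plactic_class A (u @ v)"
    by blast
  then show ?thesis
    by (simp add: plactic_def)
qed

lemma plactic_monoid: "monoid (plactic A)"
proof (rule monoidI)
  fix x y z
  assume "x \<in> carrier (plactic A)" "y \<in> carrier (plactic A)" "z \<in> carrier (plactic A)"
  then obtain u v w where "u \<in> lists A" "v \<in> lists A" "w \<in> lists A"
    "x = plactic_class A u" "y = plactic_class A v" "z = plactic_class A w"
    unfolding plactic_carrier by blast
  then show "x \<otimes>\<^bsub>plactic A\<^esub> y \<otimes>\<^bsub>plactic A\<^esub> z = x \<otimes>\<^bsub>plactic A\<^esub> (y \<otimes>\<^bsub>plactic A\<^esub> z)"
    by (simp add: plactic_class_mult del: in_lists_conv_set)
next
  fix x y
  assume "x \<in> carrier (plactic A)" "y \<in> carrier (plactic A)"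
  then obtain u v where "u \<in> lists A" "v \<in> lists A" "x = plactic_class A u" "y = plactic_class A v"
    unfolding plactic_carrier by blast
  then show "x \<otimes>\<^bsub>plactic A\<^esub> y \<in> carrier (plactic A)"
    by (auto simp: plactic_class_mult plactic_carrier intro!: imageI)
next
  fix x
  assume "x \<in> carrier (plactic A)"
  then obtain u where "u \<in> lists A" "x = plactic_class A u"
    unfolding plactic_carrier by blast
  then show "\<one>\<^bsub>plactic A\<^esub> \<otimes>\<^bsub>plactic A\<^esub> x = x" "x \<otimes>\<^bsub>plactic A\<^esub> \<one>\<^bsub>plactic A\<^esub> = x"
    by (simp_all add: plactic_one plactic_class_mult)
qed (simp add: plactic_carrier plactic_one)

text \<open>Serves to evaluate \<open>zeta\<close>, which picks a representative by
  \<open>SOME\<close>, and likewise \<open>pair_sum\<close>: an invariant of the congruence does not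
  see the choice.\<close>

lemma some_representative:
  assumes "w \<in> lists A" "\<And>u v. (u, v) \<in> plactic_cong A \<Longrightarrow> \<phi> u = \<phi> v"
  shows "\<phi> (SOME u. u \<in> plactic_class A w) = \<phi> w"
proof -
  have "w \<in> plactic_class A w"
    using assms(1) by (simp add: plactic_class_def plactic_refl)
  then have "(SOME u. u \<in> plactic_class A w) \<in> plactic_class A w"
    by (rule someI)
  then have "(w, SOME u. u \<in> plactic_class A w) \<in> plactic_cong A"
    by (simp add: plactic_class_def)
  then show ?thesis
    by (rule assms(2)[symmetric])
qed

section \<open>Letter counts as additive functions\<close>

lemma plactic_cong_count:
  assumes "(u, v) \<in> plactic_cong A"
  shows "count_list u a = count_list v a"
  using assms by (induction rule: plactic_cong.induct) (auto elim!: knuth_rel.cases)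

lemma zeta_plactic_class:
  "w \<in> lists A \<Longrightarrow> zeta a (plactic_class A w) = (\<Sum>i<count_list w a. 1)"
  unfolding zeta_def
  by (rule some_representative[where \<phi> = "\<lambda>w. \<Sum>i<count_list w a. 1"]) (auto dest: plactic_cong_count[of _ _ _ a])

lemma sum_const_lessThan_add:
  fixes c :: "'r::comm_monoid_add" and m n :: nat
  shows "(\<Sum>i<m + n. c) = (\<Sum>i<m. c) + (\<Sum>i<n. c)"
  by (induction n) (simp_all add: add_ac)

lemma zeta_mult:
  assumes "x \<in> carrier (plactic A)" "y \<in> carrier (plactic A)"
  shows "zeta a (x \<otimes>\<^bsub>plactic A\<^esub> y) = zeta a x + zeta a y"
proof -
  obtain u v where "u \<in> lists A" "v \<in> lists A" "x = plactic_class A u" "y = plactic_class A v"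
    using assms unfolding plactic_carrier by blast
  then show ?thesis
    by (simp add: plactic_class_mult zeta_plactic_class sum_const_lessThan_add)
qed

text \<open>
  As the second elementary symmetric function of the values of \<open>v\<close> at the letters, \<open>pair_sum v\<close> is
  invariant under the Knuth relations; it makes sense over any ring and trivialises the square of
  the character \<open>\<Sum>\<^sub>a v\<^sub>a \<zeta>\<^sub>a\<close> without division by 2.
\<close>

fun pair_sum :: "('a \<Rightarrow> 'r) \<Rightarrow> 'a list \<Rightarrow> 'r::{comm_ring, comm_monoid_mult}" where
  "pair_sum v [] = 0"
| "pair_sum v (a # w) = v a * sum_list (map v w) + pair_sum v w"

text \<open>A pair of positions in \<open>u @ w\<close> lies within \<open>u\<close>, within
  \<open>w\<close>, or across. The pairs across give the product term, the failure of additivity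
  that makes the square a coboundary.\<close>

lemma pair_sum_append:
  "pair_sum v (u @ w) = pair_sum v u + pair_sum v w + sum_list (map v u) * sum_list (map v w)"
  by (induction u) (simp_all add: algebra_simps)

lemma plactic_cong_sum_list:
  fixes v :: "'a::linorder \<Rightarrow> 'r::{comm_ring, comm_monoid_mult}"
  shows "(u, w) \<in> plactic_cong A \<Longrightarrow> sum_list (map v u) = sum_list (map v w)"
  by (induction rule: plactic_cong.induct) (auto elim!: knuth_rel.cases simp: algebra_simps)

lemma plactic_cong_pair_sum:
  assumes "(u, w) \<in> plactic_cong A"
  shows "pair_sum v u = pair_sum v w"
  using assms
proof (induction rule: plactic_cong.induct)
  case (plactic_mult x x' y y')
  then show ?case
    using plactic_cong_sum_list[of x x' A v] plactic_cong_sum_list[of y y' A v]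
    by (simp add: pair_sum_append)
qed (auto elim!: knuth_rel.cases simp: algebra_simps)

lemma sum_zeta_plactic_class:
  assumes "finite A" "w \<in> lists A"
  shows "(\<Sum>a\<in>A. v a * zeta a (plactic_class A w)) = sum_list (map v w)"
proof -
  have "(\<Sum>a\<in>A. v a * (\<Sum>i<count_list w a. 1)) = sum_list (map v w)"
    using assms(2)
  proof (induction w rule: list.induct)
    case (Cons b w)
    have "(\<Sum>a\<in>A. v a * (\<Sum>i<count_list (b # w) a. 1))
        = (\<Sum>a\<in>A. (if a = b then v a else 0) + v a * (\<Sum>i<count_list w a. 1))"
      by (intro sum.cong) (simp_all add: algebra_simps)
    then show ?case
      using Cons assms(1) by (simp add: sum.distrib)
  qed simp
  then show ?thesis
    using assms(2) by (simp add: zeta_plactic_class)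
qed

lemma plactic_square_trivial:
  fixes v :: "'a::linorder \<Rightarrow> 'r::{comm_ring, comm_monoid_mult}"
  assumes "finite A"
  shows "\<exists>q. \<forall>x\<in>carrier (plactic A). \<forall>y\<in>carrier (plactic A). q (x \<otimes>\<^bsub>plactic A\<^esub> y)
    = q x + q y + (\<Sum>a\<in>A. v a * zeta a x) * (\<Sum>a\<in>A. v a * zeta a y)"
proof -
  define q where "q X = pair_sum v (SOME u. u \<in> X)" for X
  have "q (plactic_class A w) = pair_sum v w" if "w \<in> lists A" for w
    unfolding q_def using that
    by (rule some_representative[where \<phi> = "pair_sum v"]) (rule plactic_cong_pair_sum)
  then show ?thesis
    by (intro exI[of _ q]) (auto simp: plactic_carrier plactic_class_mult sum_zeta_plactic_class
        assms pair_sum_append)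
qed

section \<open>Commutation of columns\<close>

lemma plactic_cong_Cons: "(u, v) \<in> plactic_cong A \<Longrightarrow> a \<in> A \<Longrightarrow> (a # u, a # v) \<in> plactic_cong A"
  using plactic_mult[OF plactic_refl[of "[a]"]] by simp

lemma plactic_cong_append_left:
  "(u, v) \<in> plactic_cong A \<Longrightarrow> w \<in> lists A \<Longrightarrow> (w @ u, w @ v) \<in> plactic_cong A"
  using plactic_mult[OF plactic_refl] by blast

lemma plactic_cong_append_right:
  "(u, v) \<in> plactic_cong A \<Longrightarrow> w \<in> lists A \<Longrightarrow> (u @ w, v @ w) \<in> plactic_cong A"
  using plactic_mult[OF _ plactic_refl] by blast

text \<open>Here \<open>x\<close> travels left through \<open>v\<close>. It passes a letter
  \<open>t\<close> by the second Knuth relation \<open>y t x ~ y x t\<close>, which asks for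
  \<open>t < y \<le> x\<close>; the left neighbour of \<open>t\<close> in the decreasing word serves
  as \<open>y\<close>.\<close>

lemma plactic_cong_move_left:
  assumes "sorted_wrt (>) (y # v)" "y \<le> x" "x \<in> A" "y # v \<in> lists A"
  shows "(y # v @ [x], y # x # v) \<in> plactic_cong A"
  using assms
proof (induction v arbitrary: y)
  case (Cons t v)
  have "(y # t # v @ [x], y # t # x # v) \<in> plactic_cong A"
    using Cons by (intro plactic_cong_Cons[where u = "t # v @ [x]"]) auto
  moreover have "([y, t, x] @ v, [y, x, t] @ v) \<in> plactic_cong A"
    using Cons.prems by (intro plactic_cong_append_right plactic_rel knuth2) auto
  ultimately show ?case
    using plactic_trans by fastforce
qed (auto intro: plactic_refl)

text \<open>Here the front \<open>x\<close> travels right through \<open>u\<close>. It passes a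
  letter \<open>s\<close> by the first Knuth relation \<open>x s n ~ s x n\<close>, which asks for
  \<open>x \<le> n < s\<close>; the right neighbour of \<open>s\<close> serves as \<open>n\<close>.
  The final \<open>x\<close> provides this neighbour for the last letter of
  \<open>u\<close>.\<close>

lemma plactic_cong_move_right:
  assumes "sorted_wrt (>) (u @ [x])" "u @ [x] \<in> lists A"
  shows "(x # u @ [x], u @ [x, x]) \<in> plactic_cong A"
  using assms
proof (induction u)
  case (Cons s u)
  obtain n t where nt: "u @ [x] = n # t"
    by (cases "u @ [x]") auto
  have "x \<le> n"
    using Cons.prems(1) nt by (cases u) auto
  moreover have "n < s"
    using Cons.prems(1) nt by (cases u) auto
  moreover have "n # t \<in> lists A"
    using Cons.prems(2) by (simp flip: nt)
  ultimately have "([x, s, n] @ t, [s, x, n] @ t) \<in> plactic_cong A"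
    using Cons.prems by (intro plactic_cong_append_right plactic_rel knuth1) auto
  then have "(x # s # u @ [x], s # x # u @ [x]) \<in> plactic_cong A"
    by (simp add: nt)
  moreover have "(s # x # u @ [x], s # u @ [x, x]) \<in> plactic_cong A"
    using Cons by (intro plactic_cong_Cons) auto
  ultimately show ?case
    using plactic_trans by fastforce
qed (auto intro: plactic_refl)

text \<open>With the column written as \<open>u x v\<close>, one has
  \<open>x u x v ~ u x x v ~ u x v x\<close>: the front \<open>x\<close> moves right up to its copy
  in the column, and one copy then moves on through the smaller letters \<open>v\<close>.\<close>

lemma plactic_cong_letter_column:
  assumes "sorted_wrt (>) c" "c \<in> lists A" "x \<in> set c"
  shows "(x # c, c @ [x]) \<in> plactic_cong A"
proof -
  obtain u v where c: "c = u @ x # v"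
    using assms(3) by (meson split_list)
  have "((x # u @ [x]) @ v, (u @ [x, x]) @ v) \<in> plactic_cong A"
    using assms by (intro plactic_cong_append_right plactic_cong_move_right)
      (auto simp: c sorted_wrt_append)
  moreover have "(u @ x # v @ [x], u @ x # x # v) \<in> plactic_cong A"
    using assms by (intro plactic_cong_append_left plactic_cong_move_left)
      (auto simp: c sorted_wrt_append)
  ultimately show ?thesis
    using plactic_trans plactic_sym by (fastforce simp: c)
qed

lemma plactic_cong_word_column:
  assumes "sorted_wrt (>) c" "c \<in> lists A" "set w \<subseteq> set c"
  shows "(w @ c, c @ w) \<in> plactic_cong A"
  using assms(3)
proof (induction w)
  case (Cons x w)
  have x: "x \<in> A" and w: "w \<in> lists A"
    using Cons assms(2) by auto
  have "(x # w @ c, x # c @ w) \<in> plactic_cong A"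
    using Cons x by (intro plactic_cong_Cons) auto
  moreover have "((x # c) @ w, (c @ [x]) @ w) \<in> plactic_cong A"
    using Cons assms w by (intro plactic_cong_append_right plactic_cong_letter_column) auto
  ultimately show ?case
    using plactic_trans by fastforce
qed (use assms(2) in \<open>auto intro: plactic_refl\<close>)

definition column :: "'a::linorder set \<Rightarrow> 'a \<Rightarrow> 'a list" where
  "column A a = rev (sorted_list_of_set {b \<in> A. b \<le> a})"

lemma set_column: "finite A \<Longrightarrow> set (column A a) = {b \<in> A. b \<le> a}"
  by (simp add: column_def)

lemma column_in_lists: "finite A \<Longrightarrow> column A a \<in> lists A"
  by (auto simp: set_column)

lemma sorted_column: "sorted_wrt (>) (column A a)"
  by (simp add: column_def sorted_wrt_rev)

lemma count_list_distinct: "distinct xs \<Longrightarrow> count_list xs x = (if x \<in> set xs then 1 else 0)"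
  by (induction xs) auto

lemma zeta_column:
  assumes "finite A" "b \<in> A"
  shows "zeta b (plactic_class A (column A a)) = (if b \<le> a then 1 else 0)"
proof -
  have "count_list (column A a) b = (if b \<le> a then 1 else 0)"
    using assms by (simp add: column_def count_list_distinct)
  then show ?thesis
    using column_in_lists[OF assms(1)] by (simp add: zeta_plactic_class)
qed

lemma columns_commute:
  assumes "finite A"
  shows "plactic_class A (column A a) \<otimes>\<^bsub>plactic A\<^esub> plactic_class A (column A b)
    = plactic_class A (column A b) \<otimes>\<^bsub>plactic A\<^esub> plactic_class A (column A a)"
proof -
  \<comment> \<open>For \<open>a \<le> b\<close> all letters of the column of \<open>a\<close> occur
    in the column of \<open>b\<close>, so they commute with it one by one.\<close>
  have "plactic_class A (column A a @ column A b) = plactic_class A (column A b @ column A a)"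
    if "a \<le> b" for a b
    using assms that
    by (intro plactic_class_eq plactic_cong_word_column sorted_column column_in_lists)
      (auto simp: set_column)
  then show ?thesis
    using linear[of a b] by (auto simp: plactic_class_mult column_in_lists[OF assms] simp del: in_lists_conv_set)
qed

section \<open>The exterior algebra\<close>

definition tensors :: "'a set \<Rightarrow> ('a list \<Rightarrow> 'r::{comm_ring, comm_monoid_mult}) set" where
  "tensors A = {F. finite {w. F w \<noteq> 0} \<and> {w. F w \<noteq> 0} \<subseteq> lists A}"

lemma tensor_algebra_eq: "tensor_algebra A = word_algebra (tensors A)"
  by (simp add: tensor_algebra_def tensors_def)

lemma tensorsI:
  assumes "finite S" "S \<subseteq> lists A" "\<And>w. F w \<noteq> 0 \<Longrightarrow> w \<in> S"
  shows "F \<in> tensors A"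
  unfolding tensors_def using assms finite_subset[of "{w. F w \<noteq> 0}" S] by blast

lemma subalgebra_set_tensors: "subalgebra_set (tensors A)"
  unfolding subalgebra_set_def
proof (intro conjI ballI allI)
  show "word_single [] \<in> tensors A"
    by (rule tensorsI[of "{[]}"]) (auto simp: word_single_def split: if_splits)
next
  fix F G :: "'a list \<Rightarrow> 'b"
  assume FG: "F \<in> tensors A" "G \<in> tensors A"
  show "(\<lambda>w. F w + G w) \<in> tensors A"
    using FG by (intro tensorsI[of "{w. F w \<noteq> 0} \<union> {w. G w \<noteq> 0}"]) (auto simp: tensors_def)
  let ?S = "(\<lambda>(u, v). u @ v) ` ({w. F w \<noteq> 0} \<times> {w. G w \<noteq> 0})"
  show "word_mult F G \<in> tensors A"
  proof (rule tensorsI[of ?S])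
    show "finite ?S" "?S \<subseteq> lists A"
      using FG by (auto simp: tensors_def dest!: subsetD)
    fix w
    assume nz: "word_mult F G w \<noteq> 0"
    show "w \<in> ?S"
    proof (rule ccontr)
      assume "w \<notin> ?S"
      then have "F (take k w) = 0 \<or> G (drop k w) = 0" for k
        by (metis (mono_tags, lifting) SigmaI append_take_drop_id case_prod_conv image_eqI mem_Collect_eq)
      then show False
        using nz word_mult_eq_0 by blast
    qed
  qed
next
  fix F :: "'a list \<Rightarrow> 'b" and r
  assume "F \<in> tensors A"
  then show "(\<lambda>w. r * F w) \<in> tensors A"
    by (intro tensorsI[of "{w. F w \<noteq> 0}"]) (auto simp: tensors_def)
qed

lemma word_single_tensors: "u \<in> lists A \<Longrightarrow> word_single u \<in> tensors A"
  by (rule tensorsI[of "{u}"]) (auto simp: word_single_def split: if_splits)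

lemma word_mult_single:
  "word_mult (word_single u) (word_single v) = (word_single (u @ v) :: 'b list \<Rightarrow> 'r::{comm_ring, comm_monoid_mult})"
proof
  fix w
  show "word_mult (word_single u) (word_single v) w = (word_single (u @ v) w :: 'r)"
  proof (induction u arbitrary: w)
    case Nil
    then show ?case by (simp add: word_mult_one_left)
  next
    case IH: (Cons a u)
    show ?case
    proof (cases w)
      case (Cons x t)
      have "(\<lambda>s. word_single (a # u) (x # s)) = (if x = a then word_single u else (\<lambda>s. 0 :: 'r))"
        by (auto simp: word_single_def fun_eq_iff)
      moreover have "word_single (a # u) [] = (0 :: 'r)"
        by (simp add: word_single_def)
      ultimately have "word_mult (word_single (a # u)) (word_single v) w
          = (if x = a then word_single (u @ v) t else 0 :: 'r)"
        by (simp add: Cons IH word_mult_zero_left)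
      then show ?thesis
        by (simp add: Cons word_single_def)
    qed (simp add: word_single_def)
  qed
qed

lemma exterior_generators:
  "{v \<otimes>\<^bsub>tensor_algebra A\<^esub> v | v. v \<in> free_module A} \<subseteq> carrier (tensor_algebra A)"
  by (auto simp: tensor_algebra_eq free_module_def subalgebra_setD[OF subalgebra_set_tensors])

lemma ideal_exterior_ideal: "ideal (exterior_ideal A) (word_algebra (tensors A))"
  unfolding exterior_ideal_def
  using ring.genideal_ideal[OF word_algebra_ring[OF subalgebra_set_tensors] exterior_generators[unfolded tensor_algebra_eq]]
  by (simp add: tensor_algebra_eq)

lemmas exterior_idealD = ideal_word_algebraD[OF subalgebra_set_tensors ideal_exterior_ideal]

lemma square_in_exterior_ideal:
  assumes "v \<in> free_module A"
  shows "word_mult v v \<in> exterior_ideal A"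
  using assms ring.genideal_self[OF word_algebra_ring[OF subalgebra_set_tensors] exterior_generators[unfolded tensor_algebra_eq]]
  unfolding exterior_ideal_def tensor_algebra_eq by auto

section \<open>Straightening of words modulo the exterior ideal\<close>

lemma exterior_ideal_square:
  assumes "a \<in> A"
  shows "word_single [a, a] \<in> exterior_ideal A"
proof -
  have "word_single [a] \<in> free_module A"
    using assms word_single_tensors[of "[a]" A]
    by (auto simp: free_module_def tensor_algebra_eq word_single_def split: if_splits)
  from square_in_exterior_ideal[OF this] show ?thesis
    by (simp add: word_mult_single)
qed

text \<open>Polarisation: the square of the sum of the two letters minus their two squares.\<close>

lemma exterior_ideal_anticommute:
  assumes "a \<in> A" "b \<in> A"
  shows "(\<lambda>w. word_single [a, b] w + word_single [b, a] w) \<in> exterior_ideal A"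
proof -
  let ?v = "\<lambda>w. word_single [a] w + word_single [b] w"
  have "?v \<in> free_module A"
    using assms subalgebra_setD(2)[OF subalgebra_set_tensors word_single_tensors[of "[a]" A] word_single_tensors[of "[b]" A]]
    by (auto simp: free_module_def tensor_algebra_eq word_single_def split: if_splits)
  from exterior_idealD(5)[OF exterior_idealD(5)[OF square_in_exterior_ideal[OF this]
      exterior_ideal_square[OF assms(1)]] exterior_ideal_square[OF assms(2)]]
  show ?thesis
    by (simp add: word_mult_add_left word_mult_add_right word_mult_single algebra_simps)
qed

text \<open>The letter \<open>a\<close> moves past smaller letters, changing the sign each time,
  until it meets a larger letter or the end, or an equal letter, which kills the word. The bound on
  \<open>set u\<close> keeps \<open>b # u\<close> increasing when the smaller letter
  \<open>b\<close> is put back in front.\<close>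

lemma exterior_reduce_Cons:
  fixes A :: "'a::linorder set"
  assumes "sorted_wrt (<) v" "a \<in> A" "v \<in> lists A"
  shows "\<exists>(c::'r::{comm_ring, comm_monoid_mult}) u. sorted_wrt (<) u \<and> set u \<subseteq> set (a # v)
    \<and> (\<lambda>w. word_single (a # v) w - c * word_single u w) \<in> exterior_ideal A"
  using assms(1,3)
proof (induction v)
  case Nil
  have "sorted_wrt (<) [a]" "(\<lambda>w. word_single [a] w - (1 :: 'r) * word_single [a] w) \<in> exterior_ideal A"
    using exterior_idealD(2) by simp_all
  then show ?case
    by fastforce
next
  case (Cons b v)
  consider "a < b" | "a = b" | "b < a"
    by fastforce
  then show ?case
  proof cases
    case 1
    then have "sorted_wrt (<) (a # b # v)"
      using Cons by fastforce
    moreover have "(\<lambda>w. word_single (a # b # v) w - (1 :: 'r) * word_single (a # b # v) w) \<in> exterior_ideal A"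
      using exterior_idealD(2) by simp
    ultimately show ?thesis
      by blast
  next
    case 2
    have "word_mult (word_single [a, a]) (word_single v :: 'a list \<Rightarrow> 'r) \<in> exterior_ideal A"
      using Cons assms(2) by (intro exterior_idealD(7) exterior_ideal_square word_single_tensors) simp_all
    \<comment> \<open>The coefficient is 0, so \<open>[]\<close> is a placeholder for an increasing
      word.\<close>
    then have "(\<lambda>w. word_single (a # b # v) w - (0 :: 'r) * word_single [] w) \<in> exterior_ideal A"
      using 2 by (simp add: word_mult_single)
    moreover have "sorted_wrt (<) []" "set [] \<subseteq> set (a # b # v)"
      by simp_all
    ultimately show ?thesis
      by blast
  next
    case 3
    obtain c :: 'r and u where u: "sorted_wrt (<) u" "set u \<subseteq> set (a # v)"
      and cu: "(\<lambda>w. word_single (a # v) w - c * word_single u w) \<in> exterior_ideal A"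
      using Cons by auto
    have sorted: "sorted_wrt (<) (b # u)" "set (b # u) \<subseteq> set (a # b # v)"
      using u 3 Cons.prems(1) by auto
    have "b \<in> A" "v \<in> lists A"
      using Cons.prems by auto
    have "word_mult (word_single [b]) (\<lambda>w. word_single (a # v) w - c * word_single u w) \<in> exterior_ideal A"
      using cu \<open>b \<in> A\<close> by (intro exterior_idealD(6) word_single_tensors) auto
    moreover have "word_mult (word_single [b]) (\<lambda>w. word_single (a # v) w - c * word_single u w)
        = (\<lambda>w. word_single (b # a # v) w - c * word_single (b # u) w)"
      by (simp add: fun_eq_iff word_mult_diff_right word_mult_scale_right word_mult_single)
    ultimately have bu: "(\<lambda>w. word_single (b # a # v) w - c * word_single (b # u) w) \<in> exterior_ideal A"
      by simp
    have "word_mult (\<lambda>w. word_single [a, b] w + word_single [b, a] w) (word_single v :: 'a list \<Rightarrow> 'r) \<in> exterior_ideal A"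
      using assms(2) \<open>b \<in> A\<close> \<open>v \<in> lists A\<close>
      by (intro exterior_idealD(7) exterior_ideal_anticommute word_single_tensors) auto
    moreover have "word_mult (\<lambda>w. word_single [a, b] w + word_single [b, a] w) (word_single v)
        = (\<lambda>w. word_single (a # b # v) w + word_single (b # a # v) w :: 'r)"
      by (simp add: fun_eq_iff word_mult_add_left word_mult_single)
    ultimately have "(\<lambda>w. word_single (a # b # v) w + word_single (b # a # v) w :: 'r) \<in> exterior_ideal A"
      by simp
    \<comment> \<open>Subtracting \<open>bu\<close> from the anticommutation relation eliminates
      \<open>b # a # v\<close> and changes the sign of \<open>c\<close>.\<close>
    then have "(\<lambda>w. (word_single (a # b # v) w + word_single (b # a # v) w)
        - (word_single (b # a # v) w - c * word_single (b # u) w)) \<in> exterior_ideal A"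
      using bu by (rule exterior_idealD(5))
    then have "(\<lambda>w. word_single (a # b # v) w - (- c) * word_single (b # u) w) \<in> exterior_ideal A"
      by (simp add: algebra_simps)
    then show ?thesis
      using sorted by blast
  qed
qed

lemma exterior_reduce_word:
  fixes A :: "'a::linorder set"
  assumes "v \<in> lists A"
  shows "\<exists>(c::'r::{comm_ring, comm_monoid_mult}) u. sorted_wrt (<) u \<and> u \<in> lists A
    \<and> (\<lambda>w. word_single v w - c * word_single u w) \<in> exterior_ideal A"
  using assms
proof (induction v rule: list.induct)
  case Nil
  have "sorted_wrt (<) []" "[] \<in> lists A"
    "(\<lambda>w. word_single [] w - (1 :: 'r) * word_single [] w) \<in> exterior_ideal A"
    using exterior_idealD(2) by simp_all
  then show ?case
    by blast
next
  case (Cons a v)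
  from Cons.prems have "v \<in> lists A"
    by simp
  from Cons.IH[OF this] obtain c :: 'r and u where u: "sorted_wrt (<) u" "u \<in> lists A"
    and cu: "(\<lambda>w. word_single v w - c * word_single u w) \<in> exterior_ideal A"
    by blast
  have a: "a \<in> A"
    using Cons.prems by simp
  obtain c' :: 'r and u' where u': "sorted_wrt (<) u'" "set u' \<subseteq> set (a # u)"
    and cu': "(\<lambda>w. word_single (a # u) w - c' * word_single u' w) \<in> exterior_ideal A"
    using exterior_reduce_Cons[OF u(1) a u(2)] by blast
  have "word_mult (word_single [a]) (\<lambda>w. word_single v w - c * word_single u w) \<in> exterior_ideal A"
    using cu a by (intro exterior_idealD(6) word_single_tensors) auto
  moreover have "word_mult (word_single [a]) (\<lambda>w. word_single v w - c * word_single u w)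
      = (\<lambda>w. word_single (a # v) w - c * word_single (a # u) w)"
    by (simp add: fun_eq_iff word_mult_diff_right word_mult_scale_right word_mult_single)
  ultimately have au: "(\<lambda>w. word_single (a # v) w - c * word_single (a # u) w) \<in> exterior_ideal A"
    by simp
  from exterior_idealD(3)[OF au exterior_idealD(4)[OF cu', of c]]
  have "(\<lambda>w. word_single (a # v) w - (c * c') * word_single u' w) \<in> exterior_ideal A"
    by (simp add: algebra_simps)
  moreover have "u' \<in> lists A"
    using u'(2) u(2) a by auto
  ultimately show ?case
    using u'(1) by blast
qed

lemma exterior_reduce:
  fixes A :: "'a::linorder set" and F :: "'a list \<Rightarrow> 'r::{comm_ring, comm_monoid_mult}"
  assumes "F \<in> tensors A"
  shows "\<exists>F'\<in>tensors A. (\<lambda>w. F w - F' w) \<in> exterior_ideal A \<and> (\<forall>w. F' w \<noteq> 0 \<longrightarrow> sorted_wrt (<) w)"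
proof -
  \<comment> \<open>The induction runs over a finite set \<open>S\<close> containing the support, so
    that it loses one word per step whether or not the coefficient there vanishes.\<close>
  have "\<exists>F'\<in>tensors A. (\<lambda>w. F w - F' w) \<in> exterior_ideal A \<and> (\<forall>w. F' w \<noteq> 0 \<longrightarrow> sorted_wrt (<) w)"
    if "finite S" "S \<subseteq> lists A" "\<And>w. F w \<noteq> 0 \<Longrightarrow> w \<in> S" for S and F :: "'a list \<Rightarrow> 'r"
    using that
  proof (induction S arbitrary: F rule: finite_induct)
    case empty
    then have "F = (\<lambda>w. 0)"
      by blast
    then show ?case
      using exterior_idealD(2) subalgebra_setD(5)[OF subalgebra_set_tensors]
      by (intro bexI[of _ "\<lambda>w. 0"]) simp_all
  next
    case (insert v S)
    define G where "G = F(v := 0)"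
    have F: "F w = G w + F v * word_single v w" for w
      by (simp add: G_def word_single_def)
    have "\<And>w. G w \<noteq> 0 \<Longrightarrow> w \<in> S" "S \<subseteq> lists A"
      using insert.prems by (auto simp: G_def split: if_splits)
    from insert.IH[OF this(2,1)]
    obtain G' where G': "G' \<in> tensors A" "(\<lambda>w. G w - G' w) \<in> exterior_ideal A"
      "\<forall>w. G' w \<noteq> 0 \<longrightarrow> sorted_wrt (<) w"
      by blast
    obtain c :: 'r and u where u: "sorted_wrt (<) u" "u \<in> lists A"
      and cu: "(\<lambda>w. word_single v w - c * word_single u w) \<in> exterior_ideal A"
      using exterior_reduce_word[of v A] insert.prems(1) by blast
    let ?F' = "\<lambda>w. G' w + F v * (c * word_single u w)"
    have "?F' \<in> tensors A"
      using G'(1) word_single_tensors[OF u(2)] by (intro subalgebra_setD[OF subalgebra_set_tensors])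
    moreover have "(\<lambda>w. F w - ?F' w)
        = (\<lambda>w. (G w - G' w) + F v * (word_single v w - c * word_single u w))"
    proof
      fix w
      show "F w - ?F' w = (G w - G' w) + F v * (word_single v w - c * word_single u w)"
        by (subst F[of w]) (simp add: algebra_simps)
    qed
    then have "(\<lambda>w. F w - ?F' w) \<in> exterior_ideal A"
      using exterior_idealD(3)[OF G'(2) exterior_idealD(4)[OF cu, of "F v"]] by simp
    moreover have "\<forall>w. ?F' w \<noteq> 0 \<longrightarrow> sorted_wrt (<) w"
      using G'(3) u(1) by (auto simp: word_single_def)
    ultimately show ?case
      by (intro bexI[of _ ?F'] conjI)
  qed
  from this[of "{w. F w \<noteq> 0}" F] assms show ?thesis
    by (auto simp: tensors_def)
qed

section \<open>Detection by commuting elements\<close>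

text \<open>
  The set \<open>S\<close> need not be closed under \<open>f\<close>: \<open>F\<close> is only tested on lists over \<open>S\<close>, whereas \<open>G\<close> is also
  evaluated at products.  So a pairwise commuting \<open>S\<close> suffices below, and it need not be a submonoid.
\<close>

definition bar_exact_on :: "('m \<Rightarrow> 'm \<Rightarrow> 'm) \<Rightarrow> 'm set \<Rightarrow> ('m list \<Rightarrow> 'r::{comm_ring, comm_monoid_mult}) \<Rightarrow> bool" where
  "bar_exact_on f S F \<longleftrightarrow> (\<exists>G. \<forall>w\<in>lists S. F w = bar_d f G w)"

lemma bar_exact_on_diff:
  assumes "bar_exact_on f S F" "bar_exact_on f S G"
  shows "bar_exact_on f S (\<lambda>w. F w - G w)"
proof -
  obtain F' G' where "\<forall>w\<in>lists S. F w = bar_d f F' w" "\<forall>w\<in>lists S. G w = bar_d f G' w"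
    using assms unfolding bar_exact_on_def by blast
  then show ?thesis
    unfolding bar_exact_on_def
    by (intro exI[of _ "\<lambda>w. F' w - G' w"]) (simp add: bar_d_diff)
qed

lemma bar_exact_on_sum:
  assumes "\<And>a. a \<in> B \<Longrightarrow> bar_exact_on f S (F a)"
  shows "bar_exact_on f S (\<lambda>w. \<Sum>a\<in>B. F a w)"
proof -
  obtain G where "\<And>a w. a \<in> B \<Longrightarrow> w \<in> lists S \<Longrightarrow> F a w = bar_d f (G a) w"
    using assms unfolding bar_exact_on_def by metis
  then show ?thesis
    unfolding bar_exact_on_def
    by (intro exI[of _ "\<lambda>w. \<Sum>a\<in>B. G a w"]) (simp add: bar_d_sum)
qed

text \<open>Insertion anticommutes with the differential on lists over \<open>S\<close>, so minus
  the insertion into a primitive of \<open>F\<close> is a primitive for the insertion into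
  \<open>F\<close>.\<close>

lemma bar_exact_on_insertion:
  assumes "bar_exact_on f S F" "m \<in> S" "\<And>x y. x \<in> S \<Longrightarrow> y \<in> S \<Longrightarrow> f x y = f y x"
  shows "bar_exact_on f S (insertion m F)"
proof -
  obtain G where G: "\<And>w. w \<in> lists S \<Longrightarrow> F w = bar_d f G w"
    using assms(1) unfolding bar_exact_on_def by blast
  have "insertion m F w = bar_d f (\<lambda>u. - insertion m G u) w" if w: "w \<in> lists S" for w
  proof -
    have "insertion m F w = insertion m (bar_d f G) w"
      using assms(2) G w by (rule insertion_cong)
    also have "\<dots> = - bar_d f (insertion m G) w"
      using w assms(2,3) by (intro insertion_bar_d) auto
    finally show ?thesis
      by (simp add: bar_d_uminus)
  qed
  then show ?thesis
    unfolding bar_exact_on_def by blast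
qed

text \<open>Triangular elimination: inserting \<open>c a\<close> gives the sum of the contractions
  with all letters \<open>b \<le> a\<close>. Those with \<open>b < a\<close> are exact by induction,
  hence so is the remaining one.\<close>

lemma bar_exact_on_tensor_insertion:
  fixes A :: "'a::linorder set"
  assumes "finite A" "\<And>x y. x \<in> S \<Longrightarrow> y \<in> S \<Longrightarrow> f x y = f y x"
    and c: "\<And>a. a \<in> A \<Longrightarrow> c a \<in> S"
    and z: "\<And>a b. a \<in> A \<Longrightarrow> b \<in> A \<Longrightarrow> z b (c a) = (if b \<le> a then 1 else 0)"
    and exact: "bar_exact_on f S (tensor_eval A z F)"
    and "a \<in> A"
  shows "bar_exact_on f S (tensor_eval A z (insertion a F))"
  using \<open>a \<in> A\<close>
\<comment> \<open>The number of smaller letters in the finite set \<open>A\<close> is the measure,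
  as the order of the type may fail to be well-founded.\<close>
proof (induction "card {b \<in> A. b < a}" arbitrary: a rule: less_induct)
  case less
  let ?D = "\<lambda>b. tensor_eval A z (insertion b F)"
  have "insertion (c a) (tensor_eval A z F) w = ?D a w + (\<Sum>b\<in>{b\<in>A. b < a}. ?D b w)" for w
  proof -
    have "insertion (c a) (tensor_eval A z F) w = (\<Sum>b\<in>A. if b \<le> a then ?D b w else 0)"
      using z less.prems by (auto simp: insertion_tensor_eval intro!: sum.cong)
    also have "\<dots> = (\<Sum>b\<in>{b\<in>A. b \<le> a}. ?D b w)"
      using assms(1) by (simp add: sum.inter_filter)
    also have "{b\<in>A. b \<le> a} = insert a {b\<in>A. b < a}"
      using less.prems by auto
    finally show ?thesis
      using assms(1) by simp
  qed
  moreover have "bar_exact_on f S (insertion (c a) (tensor_eval A z F))"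
    using exact c[OF less.prems] assms(2) by (rule bar_exact_on_insertion)
  moreover have "bar_exact_on f S (?D b)" if "b \<in> {b\<in>A. b < a}" for b
  proof (rule less.hyps)
    show "card {x \<in> A. x < b} < card {x \<in> A. x < a}"
      using that assms(1) by (intro psubset_card_mono) auto
  qed (use that in simp)
  ultimately have "bar_exact_on f S (\<lambda>w. (?D a w + (\<Sum>b\<in>{b\<in>A. b < a}. ?D b w)) - (\<Sum>b\<in>{b\<in>A. b < a}. ?D b w))"
    by (intro bar_exact_on_diff bar_exact_on_sum) presburger+
  then show ?case
    by simp
qed

lemma insertion_eq_0:
  assumes "\<And>u v. w = u @ v \<Longrightarrow> F (u @ m # v) = 0"
  shows "insertion m F w = 0"
  using assms
proof (induction w arbitrary: F)
  case (Cons x w)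
  have "insertion m (\<lambda>u. F (x # u)) w = 0"
    by (rule Cons.IH) (metis Cons.prems append_Cons)
  then show ?case
    using Cons.prems[of "[]" "x # w"] by simp
qed simp

text \<open>Contraction with the head of an increasing \<open>w\<close> keeps all hypotheses and
  shortens \<open>w\<close>, so that in the end the coefficient is read off in degree 0.\<close>

lemma sorted_tensor_vanishes:
  fixes A :: "'a::linorder set"
  assumes "finite A" "\<And>x y. x \<in> S \<Longrightarrow> y \<in> S \<Longrightarrow> f x y = f y x"
    and "\<And>a. a \<in> A \<Longrightarrow> c a \<in> S"
    and "\<And>a b. a \<in> A \<Longrightarrow> b \<in> A \<Longrightarrow> z b (c a) = (if b \<le> a then 1 else 0)"
    and "bar_exact_on f S (tensor_eval A z F)"
    and "\<And>w. F w \<noteq> 0 \<Longrightarrow> sorted_wrt (<) w"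
    and "w \<in> lists A"
  shows "F w = 0"
proof (cases "sorted_wrt (<) w")
  case True
  from True assms(5-7) show ?thesis
  proof (induction w arbitrary: F rule: list.induct)
    case Nil
    then obtain G where "\<forall>w\<in>lists S. tensor_eval A z F w = bar_d f G w"
      unfolding bar_exact_on_def by blast
    \<comment> \<open>On \<open>[]\<close> the evaluation is \<open>F []\<close>, while every
      differential vanishes.\<close>
    from this[rule_format, of "[]"] show ?case
      by simp
  next
    case (Cons a w)
    have exact: "bar_exact_on f S (tensor_eval A z (insertion a F))"
      using bar_exact_on_tensor_insertion[of A S f c z F a] assms(1-4) Cons.prems by simp
    \<comment> \<open>Adding a letter to a word that is not increasing cannot make it increasing, so
      the contraction is again supported on increasing words.\<close>
    have "insertion a F u = 0" if "\<not> sorted_wrt (<) u" for u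
      using that Cons.prems(3) by (intro insertion_eq_0) (force simp: sorted_wrt_append)
    then have "insertion a F w = 0"
      using Cons.prems(1,4) exact by (intro Cons.IH) auto
    \<comment> \<open>\<open>a\<close> is smaller than all letters of \<open>w\<close>, so only the
      insertion at the front yields an increasing word.\<close>
    moreover have "insertion a F w = F (a # w)"
    proof (cases w)
      case w: (Cons x t)
      have "insertion a (\<lambda>u. F (x # u)) t = 0"
        using Cons.prems(1,3) w by (intro insertion_eq_0) force
      then show ?thesis
        using w by simp
    qed simp
    ultimately show ?case
      by simp
  qed
qed (use assms(6) in blast)

section \<open>The embedding\<close>

definition tensor_cochain ::
    "('m, 'k) monoid_scheme \<Rightarrow> 'a set \<Rightarrow> ('a \<Rightarrow> 'm \<Rightarrow> 'r) \<Rightarrow> ('a list \<Rightarrow> 'r)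
       \<Rightarrow> 'm list \<Rightarrow> 'r::{comm_ring, comm_monoid_mult}" where
  "tensor_cochain M A z F = (\<lambda>ms. if ms \<in> lists (carrier M) then tensor_eval A z F ms else 0)"

lemma tensor_cochain_word_mult:
  "tensor_cochain M A z (word_mult F G) = word_mult (tensor_cochain M A z F) (tensor_cochain M A z G)"
proof
  fix ms
  show "tensor_cochain M A z (word_mult F G) ms = word_mult (tensor_cochain M A z F) (tensor_cochain M A z G) ms"
  proof (cases "ms \<in> lists (carrier M)")
    case True
    have "take k ms \<in> lists (carrier M)" "drop k ms \<in> lists (carrier M)" for k
      using True by (metis append_in_lists_conv append_take_drop_id)+
    then have "word_mult (tensor_cochain M A z F) (tensor_cochain M A z G) ms
        = word_mult (tensor_eval A z F) (tensor_eval A z G) ms"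
      by (intro word_mult_cong) (simp_all add: tensor_cochain_def del: in_lists_conv_set)
    with True show ?thesis
      by (simp add: tensor_cochain_def tensor_eval_word_mult)
  next
    case False
    then have "word_mult (tensor_cochain M A z F) (tensor_cochain M A z G) ms = 0"
      by (intro word_mult_outside[where S = "carrier M"]) (auto simp: tensor_cochain_def)
    with False show ?thesis
      by (simp add: tensor_cochain_def)
  qed
qed

lemma tensor_cochain_single:
  assumes "finite A" "a \<in> A"
  shows "tensor_cochain M A z (word_single [a]) = cochain1 M (z a)"
proof
  fix ms
  have "tensor_eval A z (word_single [a]) ms = (case ms of [m] \<Rightarrow> z a m | _ \<Rightarrow> 0)"
  proof (cases ms rule: remdups_adj.cases)
    case (2 m)
    have "tensor_eval A z (word_single [a]) [m] = (\<Sum>b\<in>A. if b = a then z b m else 0)"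
      by (auto simp: word_single_def intro!: sum.cong)
    then show ?thesis
      using 2 assms by simp
  next
    case (3 m n w)
    then have "tensor_eval A z (word_single [a]) ms = 0"
      by (intro tensor_eval_eq_0) (auto simp: word_single_def)
    with 3 show ?thesis
      by simp
  qed (simp add: word_single_def)
  then show "tensor_cochain M A z (word_single [a]) ms = cochain1 M (z a) ms"
    by (auto simp: tensor_cochain_def cochain1_def split: list.split)
qed

lemma tensor_cochain_cochains:
  assumes "F \<in> tensors A"
  shows "tensor_cochain M A z F \<in> cochains M"
proof -
  have fin: "finite {w. F w \<noteq> 0}"
    using assms by (simp add: tensors_def)
  \<comment> \<open>The inserted \<open>0\<close> covers the case of empty support.\<close>
  define n where "n = Max (insert 0 (length ` {w. F w \<noteq> 0}))"
  have "F w = 0" if "n < length w" for w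
    using Max_ge[of "insert 0 (length ` {w. F w \<noteq> 0})" "length w"] fin that
    by (auto simp: n_def)
  then show ?thesis
    by (intro cochainsI[where n = n]) (auto simp: tensor_cochain_def intro!: tensor_eval_eq_0)
qed

section \<open>Descent to the exterior algebra and injectivity\<close>

context monoid
begin

lemma tensor_cochain_hom:
  assumes "\<And>a x y. a \<in> A \<Longrightarrow> x \<in> carrier G \<Longrightarrow> y \<in> carrier G \<Longrightarrow> z a (x \<otimes> y) = z a x + z a y"
  shows "tensor_cochain G A z \<in> algebra_hom (word_algebra (tensors A)) (word_algebra (cocycles G))"
proof -
  have "hochschild_d G eps1 eps1 (tensor_cochain G A z F) = (\<lambda>w. 0)" for F
  proof
    fix w
    show "hochschild_d G eps1 eps1 (tensor_cochain G A z F) w = 0"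
    proof (cases "w \<in> lists (carrier G)")
      case True
      then have "bar_d (mult G) (tensor_cochain G A z F) w = bar_d (mult G) (tensor_eval A z F) w"
        by (intro bar_d_cong[where S = "carrier G"]) (auto simp: tensor_cochain_def)
      also have "\<dots> = 0"
        using assms True by (rule bar_d_tensor_eval)
      finally show ?thesis
        by (simp add: hochschild_d_alt)
    qed (simp add: hochschild_d_outside)
  qed
  then have "tensor_cochain G A z F \<in> cocycles G" if "F \<in> tensors A" for F
    using that by (simp add: cocycles_def tensor_cochain_cochains)
  moreover have "tensor_cochain G A z (word_single []) = word_single []"
  proof
    fix ms
    show "tensor_cochain G A z (word_single []) ms = word_single [] ms"
      by (cases ms) (auto simp: tensor_cochain_def word_single_def tensor_eval_eq_0)
  qed
  ultimately show ?thesis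
    by (auto simp: algebra_hom_def ring_hom_def tensor_cochain_word_mult)
      (auto simp: tensor_cochain_def tensor_eval_add tensor_eval_scale fun_eq_iff)
qed

text \<open>At \<open>[x, y]\<close> the differential of a 1-cochain \<open>p\<close> is
  \<open>p y - p (x \<otimes> y) + p x\<close>, so \<open>- q\<close> is a primitive of the product
  there. In all other degrees both sides vanish.\<close>

lemma square_coboundary:
  assumes q: "\<And>x y. x \<in> carrier G \<Longrightarrow> y \<in> carrier G \<Longrightarrow>
      q (x \<otimes> y) = q x + q y + (\<Sum>a\<in>A. v [a] * z a x) * (\<Sum>a\<in>A. v [a] * z a y)"
    and v: "v \<in> free_module A"
  shows "tensor_cochain G A z (word_mult v v) \<in> coboundaries G"
proof -
  let ?f = "\<lambda>x. \<Sum>a\<in>A. v [a] * z a x"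
  let ?q = "cochain1 G (\<lambda>x. - q x)"
  have v1: "v w = 0" if "length w \<noteq> 1" for w
    using v that by (auto simp: free_module_def)
  define g where "g = tensor_eval A z v"
  have g: "g w = (case w of [x] \<Rightarrow> ?f x | _ \<Rightarrow> 0)" for w
  proof (cases w rule: remdups_adj.cases)
    case (3 x y u)
    then have "tensor_eval A z v w = 0"
      by (intro tensor_eval_eq_0 v1) auto
    with 3 show ?thesis
      by (simp add: g_def)
  qed (simp_all add: g_def v1 mult.commute)
  have "tensor_cochain G A z (word_mult v v) w = hochschild_d G eps1 eps1 ?q w" for w
  proof (cases "w \<in> lists (carrier G)")
    case True
    have "word_mult g g w = bar_d (mult G) ?q w"
      using True
    proof (cases w rule: remdups_adj.cases)
      case (3 x y u)
      show ?thesis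
      proof (cases u)
        case Nil
        then show ?thesis
          using True 3 q by (simp add: g cochain1_def)
      next
        case (Cons t s)
        have "bar_d (mult G) (\<lambda>u. ?q (x # u)) (y # t # s) = 0"
          by (cases s) (simp_all add: cochain1_def bar_d_zero)
        then show ?thesis
          using 3 Cons by (simp add: g cochain1_def word_mult_zero_left)
      qed
    qed (simp_all add: g)
    with True show ?thesis
      by (simp add: g_def tensor_cochain_def tensor_eval_word_mult hochschild_d_alt)
  qed (simp add: tensor_cochain_def hochschild_d_outside)
  moreover have "?q \<in> cochains G"
    by (intro cochainsI[where n = 1]) (auto simp: cochain1_def split: list.split)
  ultimately show ?thesis
    unfolding coboundaries_def by blast
qed

text \<open>\<open>squares\<close> makes the map on tensors vanish in cohomology on the exterior
  ideal. Conversely, the commuting elements \<open>c a\<close> detect combinations of increasing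
  words, and modulo the ideal every tensor is one; so the kernel is exactly the ideal.\<close>

proposition exterior_algebra_embeds:
  fixes A :: "'l::linorder set" and z :: "'l \<Rightarrow> 'a \<Rightarrow> 'r::{comm_ring, comm_monoid_mult}"
  assumes "finite A"
    and additive: "\<And>a x y. a \<in> A \<Longrightarrow> x \<in> carrier G \<Longrightarrow> y \<in> carrier G \<Longrightarrow> z a (x \<otimes> y) = z a x + z a y"
    and squares: "\<And>v. \<exists>q. \<forall>x\<in>carrier G. \<forall>y\<in>carrier G.
      q (x \<otimes> y) = q x + q y + (\<Sum>a\<in>A. v a * z a x) * (\<Sum>a\<in>A. v a * z a y)"
    and c: "\<And>a. a \<in> A \<Longrightarrow> c a \<in> carrier G"
    and commute: "\<And>a b. a \<in> A \<Longrightarrow> b \<in> A \<Longrightarrow> c a \<otimes> c b = c b \<otimes> c a"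
    and unitriangular: "\<And>a b. a \<in> A \<Longrightarrow> b \<in> A \<Longrightarrow> z b (c a) = (if b \<le> a then 1 else 0)"
  shows "\<exists>\<Phi>. \<Phi> \<in> algebra_hom (exterior_algebra A) (hochschild_cohomology G)
    \<and> (\<forall>a\<in>A. \<Phi> (exterior_gen A a) = cohomology_class G (cochain1 G (z a)))
    \<and> inj_on \<Phi> (carrier (exterior_algebra A))"
proof -
  let ?h = "tensor_cochain G A z"
  let ?T = "word_algebra (tensors A) :: ('r, 'l list \<Rightarrow> 'r) module"
  let ?Z = "word_algebra (cocycles G) :: ('r, 'a list \<Rightarrow> 'r) module"
  have h: "?h \<in> algebra_hom ?T ?Z"
    using additive by (rule tensor_cochain_hom)
  \<comment> \<open>\<open>K\<close> is the kernel of the map from the tensor algebra to cohomology;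
    it is shown to be the exterior ideal.\<close>
  define K where "K = {F \<in> carrier ?T. ?h F \<in> coboundaries G}"
  interpret T: ring ?T
    by (rule word_algebra_ring[OF subalgebra_set_tensors])
  interpret h: ring_hom_ring ?T ?Z ?h
    using h by (intro ring_hom_ringI2 word_algebra_ring subalgebra_set_tensors subalgebra_set_cocycles)
      (simp_all add: algebra_hom_def)
  have "ideal K ?T"
    unfolding K_def by (rule h.ideal_vimage[OF ideal_coboundaries])
  moreover have "{v \<otimes>\<^bsub>?T\<^esub> v | v. v \<in> free_module A} \<subseteq> K"
  proof clarify
    fix v :: "'l list \<Rightarrow> 'r"
    assume v: "v \<in> free_module A"
    obtain q where "\<forall>x\<in>carrier G. \<forall>y\<in>carrier G.
        q (x \<otimes> y) = q x + q y + (\<Sum>a\<in>A. v [a] * z a x) * (\<Sum>a\<in>A. v [a] * z a y)"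
      \<comment> \<open>The coefficients of a tensor of degree one sit at the one-letter
        words.\<close>
      using squares[of "\<lambda>a. v [a]"] by blast
    then have "?h (word_mult v v) \<in> coboundaries G"
      using v by (intro square_coboundary[where q = q]) auto
    moreover have "v \<in> tensors A"
      using v by (simp add: free_module_def tensor_algebra_eq)
    ultimately show "v \<otimes>\<^bsub>?T\<^esub> v \<in> K"
      by (simp add: K_def subalgebra_setD[OF subalgebra_set_tensors])
  qed
  ultimately have ideal_K: "exterior_ideal A \<subseteq> K"
    unfolding exterior_ideal_def tensor_algebra_eq by (rule T.genideal_minimal)
  have "F \<in> exterior_ideal A" if F: "F \<in> K" for F
  proof -
    have "F \<in> tensors A"
      using F by (simp add: K_def)
    then obtain F' where F': "F' \<in> tensors A" "(\<lambda>w. F w - F' w) \<in> exterior_ideal A"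
      "\<forall>w. F' w \<noteq> 0 \<longrightarrow> sorted_wrt (<) w"
      using exterior_reduce by blast
    \<comment> \<open>This function is \<open>F'\<close>, written as a difference of two elements of
      \<open>K\<close>.\<close>
    have "(\<lambda>w. F w - (F w - F' w)) \<in> K"
      using ideal_word_algebraD(5)[OF subalgebra_set_tensors \<open>ideal K ?T\<close> F subsetD[OF ideal_K F'(2)]] .
    then have "?h F' \<in> coboundaries G"
      by (simp add: K_def)
    then obtain H where H: "?h F' = hochschild_d G eps1 eps1 H"
      by (auto simp: coboundaries_def)
    \<comment> \<open>The coboundary is restricted to lists of the elements \<open>c a\<close>.
      These commute pairwise, as contraction requires, while \<open>H\<close> may still be evaluated
      at their products.\<close>
    have "tensor_eval A z F' w = bar_d (mult G) H w" if "w \<in> lists (c ` A)" for w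
    proof -
      have "w \<in> lists (carrier G)"
        using that c by auto
      with fun_cong[OF H, of w] show ?thesis
        by (simp add: tensor_cochain_def hochschild_d_alt)
    qed
    then have exact: "bar_exact_on (mult G) (c ` A) (tensor_eval A z F')"
      unfolding bar_exact_on_def by blast
    have "F' w = 0" for w
    proof (cases "w \<in> lists A")
      case True
      show ?thesis
        by (rule sorted_tensor_vanishes[where c = c and z = z and S = "c ` A" and f = "mult G"])
          (use assms(1) commute unitriangular exact F'(3) True in auto)
    qed (use F'(1) in \<open>auto simp: tensors_def\<close>)
    with F'(2) show ?thesis
      by simp
  qed
  with ideal_K have I: "exterior_ideal A = {F \<in> carrier ?T. ?h F \<in> coboundaries G}"
    unfolding K_def by blast
  obtain \<Phi> where \<Phi>: "\<Phi> \<in> algebra_hom (quot_algebra ?T (exterior_ideal A)) (quot_algebra ?Z (coboundaries G))"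
    "inj_on \<Phi> (carrier (quot_algebra ?T (exterior_ideal A)))"
    "\<And>F. F \<in> carrier ?T \<Longrightarrow> \<Phi> (exterior_ideal A +>\<^bsub>?T\<^esub> F) = coboundaries G +>\<^bsub>?Z\<^esub> ?h F"
    using quot_algebra_injective_hom[OF scalar_algebra_word_algebra[OF subalgebra_set_tensors]
        scalar_algebra_word_algebra[OF subalgebra_set_cocycles] ideal_coboundaries h I] by blast
  have "\<Phi> (exterior_gen A a) = cohomology_class G (cochain1 G (z a))" if "a \<in> A" for a
    using \<Phi>(3)[of "word_single [a]"] word_single_tensors[of "[a]" A] that
      tensor_cochain_single[OF assms(1) that, of G z]
    by (simp add: exterior_gen_def cohomology_class_def tensor_algebra_eq)
  with \<Phi>(1,2) show ?thesis
    by (intro exI[of _ \<Phi>])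
      (simp add: exterior_algebra_def hochschild_cohomology_def tensor_algebra_eq)
qed

end

theorem theorem7p2:
  fixes A :: "'a::linorder set"
  assumes "finite A"
  shows "\<exists>\<Phi>. \<Phi> \<in> algebra_hom
            (exterior_algebra A :: ('r::{comm_ring, comm_monoid_mult}, ('a list \<Rightarrow> 'r) set) module)
            (hochschild_cohomology (plactic A))
        \<and> (\<forall>a\<in>A. \<Phi> (exterior_gen A a) = cohomology_class (plactic A) (cochain1 (plactic A) (zeta a)))
        \<and> inj_on \<Phi> (carrier (exterior_algebra A))"
proof (rule monoid.exterior_algebra_embeds[OF plactic_monoid assms,
      where c = "\<lambda>a. plactic_class A (column A a)"])
  show "\<exists>q. \<forall>x\<in>carrier (plactic A). \<forall>y\<in>carrier (plactic A). q (x \<otimes>\<^bsub>plactic A\<^esub> y)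
      = q x + q y + (\<Sum>a\<in>A. v a * zeta a x) * (\<Sum>a\<in>A. v a * zeta a y)" for v :: "'a \<Rightarrow> 'r"
    using assms by (rule plactic_square_trivial)
  show "plactic_class A (column A a) \<in> carrier (plactic A)" for a
    using column_in_lists[OF assms] by (simp add: plactic_carrier)
qed (simp_all add: assms zeta_mult columns_commute zeta_column)

end
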